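(* Consider the Vantage protocol with Direct Availability-Graded Broadcast (Direct AGB) and the fast-seal wrapper, among $n\ge 3f+1$ parties at most $f$ of which are Byzantine, as specified in the context. (1) Without any timing assumptions: no two correct parties complete different proposals in one view; every direct result (full or core) is compatible with the unique completion (i.e. it names the payload of the unique completed proposal of that view, and full and core direct results do not both occur in one view); and the core $C$ of a completed proposal $(C,T)$ is valid, author-backed, and permanently retrievable. (2) Every view $v$ past the pacemaker cutoff whose proposer is correct and proposes $(C,T)$ completes at all correct parties, provided that at every correct party $p_i$ the persistent core check $\mathsf{CoreOK}_i(C)$ holds no later than the end of $p_i$'s echo window in view $v$. (3) In an all-correct responsive suffix, a prefix-extending proposal $B_v=(C_v,T_v)$ is fast-sealed as $\mathsf{commit\text{-}full}(C_v,T_v)$ at every party within $2\delta$ of its send, and the Direct AGB READY path seals it as $\mathsf{commit\text{-}full}(C_v,T_v)$ (by a direct result) at every party within $3\delta$ of its send.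
   Context: Model. There is a fixed set $\Pi=\{p_1,\dots,p_n\}$ of $n\ge 3f+1$ parties. A static, computationally bounded adversary fixes before the execution at most $f$ Byzantine parties, which may deviate arbitrarily; all others are correct. Put $Q=n-f$; a quorum is any set of $Q$ parties. Every pair of parties shares a reliable authenticated point-to-point channel: the receiver learns the sender, messages between correct parties cannot be forged or altered and are eventually delivered; channels need not be FIFO, and authentication is not transferable. A broadcast goes to all parties including the sender, which delivers its own message immediately. "First-hand" (or "direct") means received on the channel from the author itself; all counts are over distinct authors of first-hand messages. Partial synchrony: there are an unknown time GST and a known $\Delta$ such that a message between correct parties sent at $t$ arrives by $\max(t,\mathrm{GST})+\Delta$; $\delta\le\Delta$ is the execution's actual bound, i.e. such a message arrives by $\max(t,\mathrm{GST})+\delta$. Local clocks are monotone and, after GST, measure elapsed real time without drift; a timer of duration $\theta$ armed before GST expires at most $\theta$ real time after GST. At a local deadline a party processes every message delivered by that deadline, and the positive rules these enable, before the timeout rule. Executions are fair and non-Zeno: finitely many events in finite time, enabled actions of correct parties are eventually taken, a correct holder eventually serves a request of a correct party. The hash function $\mathcal H$ is treated as collision-free. Author lanes. A height-$k$ data block of author $p_a$ is $b=(\mathsf{sid},a,k,h',x)$ with session id, payload of bounded length, and predecessor hash $h'$ (the height-0 genesis hash is fixed); its identifier is $\mathcal H(b)$. $\mathsf{BlockOK}$ is a fixed deterministic predicate on blocks. A valid lane prefix is a hash chain of blocks with one author index, consecutive heights and matching predecessor hashes back to genesis, all satisfying $\mathsf{BlockOK}$. A correct author only creates valid extensions of its own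 current lane and sends each new block in a $\mathsf{publish}$ message to all parties. A reference $(a,k,h)$ names the block with hash $h$ and, through predecessor hashes, its lane prefix. $\mathsf{DirectPub}_j(a,k,h)$: $p_j$ holds the valid lane prefix ending at $h$ and received every block of it in $\mathsf{publish}$ messages directly from $p_a$. Each proposal ECHO of $p_i$ also carries availability claims for the references named in the proposal, outside the identity of the ECHO: an exact-position bit for $(a,k,h)$, set by a correct party iff $\mathsf{DirectPub}_i(a,k,h)$, or otherwise an integer $d$, $0<d<k$, for the greatest ancestor of $h$ (at height $k-d$, found by a verified predecessor walk) that is directly published at $p_i$. A receiver counts the exact bit as an acknowledgment by the ECHO's sender of $(a,k,h)$, and, after verifying the predecessor chain, of all its ancestors; an integer claim counts, after verification of the chain, for the ancestor at height $k-d$ and all its ancestors. A reference is $q$-available at a party that has counted acknowledgments of it from $q$ distinct parties, and exact-$q$-available if those all came from exact-position bits for that reference. $\mathsf{AuthorOK}_j(a,k,h)$ means $\mathsf{DirectPub}_j(a,k,h)$ or $(a,k,h)$ is $(f+1)$-available at $p_j$; for a manifest it means this for every entry. Missing blocks of references in a fixed well-formed proposal, a completion or a seal, or anchoring a counted claim, are requested from all parties, recursively to genesis; a correct holder answers. Repaired blocks never create $\mathsf{DirectPub}$ or acknowledgments. Correct parties permanently retain and serve every valid lane prefix they acknowledge or rely on in a check. A manifest is author-backed if for each entry some correct party permanently holds the named valid lane prefix and received each of its blocks in $\mathsf{publish}$ messages directly from the encoded author; retrievable means some correct party permanently retains the prefix; valid means all blocks satisfy $\mathsf{BlockOK}$.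 Direct AGB in view $v$. Proposer: $\mathsf{Proposer}(v)=p_{1+((v-1)\bmod n)}$. A proposal is $B=(C,T)$ (core and tip manifest), each listing at most one reference per author; it is well formed if additionally all hashes across $C$ and $T$ are distinct and every reference has canonical positive height and hash. $\mathsf{CoreOK}_i(C):=\mathsf{AuthorOK}_i(C)$. $\mathsf{TipOK}_i(C,T):=\mathsf{AuthorOK}_i(T)$ and tip anchoring: for every author present in both manifests, $p_i$ holds the full lane prefix of the tip entry and it strictly contains the author's core entry. Both are persistent. Let $\theta_E=3\Delta$, $\theta_R=4\Delta$, and let $e_i(v)$ be the time $p_i$ enters $v$. (R2) $p_i$ fixes the first view-$v$ proposal received directly from the proposer and ignores later ones; a malformed one is never echoed. A fixed well-formed proposal is active once $p_i$ activates or enters $v$. While its echo-stage response is pending and the proposal is active, as soon as $\mathsf{CoreOK}_i(C)$ and $\mathsf{TipOK}_i(C,T)$ both hold it broadcasts a grade-1 ECHO of $(C,T)$. After entry, with $t$ the later of entry and direct receipt, the echo (fallback) window is $[t,\min\{t+\Delta,e_i(v)+\theta_E\}]$; if nothing was sent by its end, $p_i$ broadcasts a grade-0 ECHO if $\mathsf{CoreOK}_i(C)$ holds and $\mathsf{echo\text{-}skip}$ otherwise. If no well-formed proposal is active by $e_i(v)+\theta_E$, it broadcasts $\mathsf{echo\text{-}skip}$. Exactly one immutable echo-stage response is sent per view. (R3) Independently of entry, while its initial ready-stage response is pending: upon counting $Q$ ECHOs (any grades) naming one $B$, $p_i$ broadcasts READY for $B$ with grade $1$ (resp. $0$) if it has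 counted $Q$ grade-1 (resp. grade-0) ECHOs for $B$, and grade mix otherwise. A mix READY is provisional: if, before all $n$ echo-stage responses are counted and before $e_i(v)+\theta_R$, one grade reaches $Q$ ECHOs for $B$, $p_i$ broadcasts one READY refinement for the same $B$ with that grade. If $p_i$ has entered and sent no READY by $e_i(v)+\theta_R$ it broadcasts $\mathsf{no\text{-}ready}$. A receiver counts only the first echo-stage and first ready-stage statement per author; after a first-counted READY-mix for $B$ it also accepts one later homogeneous READY for the same $B$ into that grade's tally, without counting the author again. (R4) Upon counting $Q$ READYs for a common $B=(C,T)$, grades ignored, $p_i$ completes $v$ with $B$ (fixing the core $C$). Upon the first homogeneous quorum of $Q$ READYs for $B$, it emits the direct result (direct seal) $\mathsf{commit\text{-}full}(C,T)$ for grade 1, $\mathsf{commit\text{-}core}(C)$ for grade 0. Counting continues after completion. Vantage proposer policy. A correct proposer's core lists, for each author, the newest (greatest height, ties by smallest hash) directly published reference that is exact-$Q$-available at it; its tip lists, for each non-quarantined author, the least-height directly published prefix strictly above its core entry (genesis if none) that is $Q$-available but not exact-$Q$-available, if one exists, and otherwise the newest directly published lane tip strictly extending the core entry (hashes already listed under an earlier author are skipped). Quarantine: when a proposal first completes at a party with neither READY grade at quorum, each tip entry that is not exact-$Q$-available is stored in its author's empty quarantine slot; quarantined authors are omitted from later tips, except that at most one due quarantined author per proposal is retried, with gaps $1,2,4,\dots$ of own proposer turns; the slot clears when the stored reference becomes exact-$Q$-available or is contained in a current core candidate. Pacemaker. $p_i$ stores the largest directly received WISH value $\omega_i[j]$ of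 each $p_j$ (initially 0); $\omega_i^+$ and $\omega_i^Q$ are the $(f+1)$st and $Q$th largest entries. Genesis enters view 1 and broadcasts WISH 2; responses for views $\le 0$ are fixed. When $\omega_i^+$ exceeds its own largest wish, $p_i$ broadcasts a WISH for $\omega_i^+$; when $\omega_i^Q$ increases it enters all missing views up to $\omega_i^Q$ immediately in order. Before sending whichever of its echo-stage response for $v-1$ and initial ready-stage response for $v-2$ completes that pair, $p_i$ raises its own wish to at least $v+1$ (piggybacked on responses). Responsive frontier $a_i$, initially 0: entering $v$ raises $a_i$ to at least $v-1$; when the fixed proposal of view $a_i+1$ is well formed, $a_i$ increases by one and that view is activated (repeatedly, in order). $\mathsf{Proposer}(v)$ broadcasts its proposal once, as soon as $a_i\ge v-1$ or $\omega_i^+\ge v$. Fast seal. A party that has counted, from all $n$ parties, grade-1 ECHOs for one $B=(C,T)$ in view $v$ fast-seals $\mathsf{commit\text{-}full}(C,T)$. Terms in the claim. Pacemaker cutoff: a finite view (which exists) such that for every later view $v$, with $s$ the time of the first correct entry to $v$: $s\ge\mathrm{GST}$, every correct party enters $v$ by $s+2\delta$, a correct $\mathsf{Proposer}(v)$ sends its well-formed proposal by $s+\delta$, and not before GST. When all parties are correct it can be chosen so that moreover every party enters $v$ by $s+\delta$. Write $\beta_v$ for the send time of $B_v$. $B_v$ is prefix-extending if every lower view's proposal was sent by $\beta_v$. An all-correct responsive suffix: every party is correct, and one considers views $v\ge r$, where $r$ is past the all-correct cutoff and every view below $r$ has been proposed, and sealed and fully output at every party, by time $\beta_r$. *)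

theory Defs
  imports Complex_Main
begin

section \<open>Blocks, manifests, messages\<close>

text \<open>Parties, authors, views and heights are natural numbers; the parties are \<open>{1..n}\<close>
  and views count from 1.\<close>

datatype ('s, 'h, 'x) block =
  Block (bsid: 's) (bauthor: nat) (bheight: nat) (bprev: 'h) (bpayload: 'x)

type_synonym 'h ref = "nat \<times> nat \<times> 'h"  \<comment> \<open>(author, height, hash)\<close>
type_synonym 'h manifest = "nat \<Rightarrow> (nat \<times> 'h) option"  \<comment> \<open>at most one (height, hash) per author\<close>
type_synonym 'h proposal = "'h manifest \<times> 'h manifest"  \<comment> \<open>(core, tip)\<close>

datatype claim = Exact | Depth nat

datatype grade = G0 | G1
datatype ready_grade = Hom grade | Mix

text \<open>The last component of the four response messages is the piggybacked WISH of the sender.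
  Availability claims are a separate component of an ECHO, outside the triple
  (view, grade, proposal) that the ECHO names.\<close>

datatype ('s, 'h, 'x) msg =
    Publish "('s, 'h, 'x) block"
  | Request 'h
  | Repair "('s, 'h, 'x) block"
  | Proposal nat "'h proposal"
  | Echo nat grade "'h proposal" "'h ref \<Rightarrow> claim option" nat
  | EchoSkip nat nat
  | Ready nat ready_grade "'h proposal" nat
  | NoReady nat nat
  | Wish nat

datatype ('s, 'h, 'x) event =
    Bcast nat "('s, 'h, 'x) msg"  \<comment> \<open>sender\<close>
  | Send nat nat "('s, 'h, 'x) msg"  \<comment> \<open>sender, receiver\<close>
  | Deliver nat nat "('s, 'h, 'x) msg"  \<comment> \<open>sender, receiver\<close>
  | Idle

text \<open>Results by which a view is sealed. \<open>CommitNone\<close> stands for a seal without payload; it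
  arises only from sealing rules outside Direct AGB and the fast-seal wrapper.\<close>

datatype 'h outcome = CommitFull "'h manifest" "'h manifest" | CommitCore "'h manifest" | CommitNone

definition mrefs :: "'h manifest \<Rightarrow> 'h ref set" where
  "mrefs M = {(a, k, h). M a = Some (k, h)}"

definition refs :: "'h proposal \<Rightarrow> 'h ref set" where
  "refs B = mrefs (fst B) \<union> mrefs (snd B)"

fun payload :: "'h outcome \<Rightarrow> 'h ref set" where
  "payload (CommitFull C T) = mrefs C \<union> mrefs T"
| "payload (CommitCore C) = mrefs C"
| "payload CommitNone = {}"

section \<open>Executions\<close>

text \<open>A configuration together with an infinite trace. Event \<open>k\<close> happens at real time
  \<open>tm k\<close>; \<open>Idle\<close> pads traces in which nothing else happens. State \<open>m\<close> is the state after
  the events with index below \<open>m\<close>, and event \<open>m\<close> is taken in state \<open>m\<close>. \<open>clk i t\<close> is the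
  local clock of party \<open>i\<close> at real time \<open>t\<close>.
  \<open>xseal i m v o\<close> says that \<open>i\<close> has by state \<open>m\<close> sealed view \<open>v\<close> with \<open>o\<close> by some rule other
  than a direct result or a fast seal, and \<open>outp i m\<close> are the blocks \<open>i\<close> has output; the rules
  behind both lie outside this model, so they are essentially unconstrained.\<close>

record ('s, 'h, 'x) execution =
  num :: nat
  flt :: nat
  byz :: "nat set"
  Delta :: real
  delta :: real
  gst :: real
  hash :: "('s, 'h, 'x) block \<Rightarrow> 'h"
  gen_hash :: 'h
  block_ok :: "('s, 'h, 'x) block \<Rightarrow> bool"
  session :: 's
  plen :: "'x \<Rightarrow> nat"
  plen_max :: nat
  clk :: "nat \<Rightarrow> real \<Rightarrow> real"
  ev :: "nat \<Rightarrow> ('s, 'h, 'x) event"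
  tm :: "nat \<Rightarrow> real"
  store :: "nat \<Rightarrow> nat \<Rightarrow> ('s, 'h, 'x) block set"
  xseal :: "nat \<Rightarrow> nat \<Rightarrow> nat \<Rightarrow> 'h outcome \<Rightarrow> bool"
  outp :: "nat \<Rightarrow> nat \<Rightarrow> ('s, 'h, 'x) block set"

definition parties :: "('s, 'h, 'x) execution \<Rightarrow> nat set" where
  "parties X = {1..num X}"

definition correct :: "('s, 'h, 'x) execution \<Rightarrow> nat set" where
  "correct X = parties X - byz X"

definition quorum :: "('s, 'h, 'x) execution \<Rightarrow> nat" where
  "quorum X = num X - flt X"

definition proposer :: "('s, 'h, 'x) execution \<Rightarrow> nat \<Rightarrow> nat" where
  "proposer X v = 1 + ((v - 1) mod num X)"

definition now :: "('s, 'h, 'x) execution \<Rightarrow> nat \<Rightarrow> real" where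
  "now X m = (if m = 0 then 0 else tm X (m - 1))"

definition by_time :: "('s, 'h, 'x) execution \<Rightarrow> real \<Rightarrow> (nat \<Rightarrow> bool) \<Rightarrow> bool" where
  "by_time X t P \<longleftrightarrow> (\<exists>m. now X m \<le> t \<and> P m)"

text \<open>A broadcast is delivered to its own sender at the very event that sends it.\<close>

definition recv_at :: "('s, 'h, 'x) execution \<Rightarrow> nat \<Rightarrow> nat \<Rightarrow> nat \<Rightarrow> ('s, 'h, 'x) msg \<Rightarrow> bool" where
  "recv_at X k i j msg \<longleftrightarrow> ev X k = Deliver j i msg \<or> (j = i \<and> ev X k = Bcast i msg)"

definition first_at ::
  "('s, 'h, 'x) execution \<Rightarrow> nat \<Rightarrow> nat \<Rightarrow> nat \<Rightarrow> (('s, 'h, 'x) msg \<Rightarrow> bool) \<Rightarrow> ('s, 'h, 'x) msg \<Rightarrow> bool"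
  where
  "first_at X k i j P msg \<longleftrightarrow>
     recv_at X k i j msg \<and> P msg \<and> (\<forall>k'<k. \<forall>msg'. recv_at X k' i j msg' \<longrightarrow> \<not> P msg')"

definition first_recv ::
  "('s, 'h, 'x) execution \<Rightarrow> nat \<Rightarrow> nat \<Rightarrow> nat \<Rightarrow> (('s, 'h, 'x) msg \<Rightarrow> bool) \<Rightarrow> ('s, 'h, 'x) msg \<Rightarrow> bool"
  where
  "first_recv X i m j P msg \<longleftrightarrow> (\<exists>k<m. first_at X k i j P msg)"

fun is_proposal :: "nat \<Rightarrow> ('s, 'h, 'x) msg \<Rightarrow> bool" where
  "is_proposal v (Proposal u B) \<longleftrightarrow> u = v"
| "is_proposal v _ \<longleftrightarrow> False"

fun echo_stage :: "nat \<Rightarrow> ('s, 'h, 'x) msg \<Rightarrow> bool" where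
  "echo_stage v (Echo u g B cl w) \<longleftrightarrow> u = v"
| "echo_stage v (EchoSkip u w) \<longleftrightarrow> u = v"
| "echo_stage v _ \<longleftrightarrow> False"

fun ready_stage :: "nat \<Rightarrow> ('s, 'h, 'x) msg \<Rightarrow> bool" where
  "ready_stage v (Ready u rg B w) \<longleftrightarrow> u = v"
| "ready_stage v (NoReady u w) \<longleftrightarrow> u = v"
| "ready_stage v _ \<longleftrightarrow> False"

fun wish_of :: "('s, 'h, 'x) msg \<Rightarrow> nat option" where
  "wish_of (Wish w) = Some w"
| "wish_of (Echo v g B cl w) = Some w"
| "wish_of (EchoSkip v w) = Some w"
| "wish_of (Ready v rg B w) = Some w"
| "wish_of (NoReady v w) = Some w"
| "wish_of _ = None"

text \<open>\<open>sent X i m P\<close>: party \<open>i\<close> has by state \<open>m\<close> broadcast a message satisfying \<open>P\<close>.\<close>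

definition sent :: "('s, 'h, 'x) execution \<Rightarrow> nat \<Rightarrow> nat \<Rightarrow> (('s, 'h, 'x) msg \<Rightarrow> bool) \<Rightarrow> bool" where
  "sent X i m P \<longleftrightarrow> (\<exists>k<m. \<exists>msg. ev X k = Bcast i msg \<and> P msg)"

section \<open>Author lanes and availability\<close>

definition data_block :: "('s, 'h, 'x) execution \<Rightarrow> ('s, 'h, 'x) block \<Rightarrow> bool" where
  "data_block X b \<longleftrightarrow> bsid b = session X \<and> plen X (bpayload b) \<le> plen_max X"

text \<open>Lane prefixes are lists from height 1 upwards; genesis (height 0) is not an element.\<close>

definition hash_chain :: "('s, 'h, 'x) execution \<Rightarrow> nat \<Rightarrow> ('s, 'h, 'x) block list \<Rightarrow> bool" where
  "hash_chain X a bs \<longleftrightarrow> (\<forall>l<length bs.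
     data_block X (bs ! l) \<and> bauthor (bs ! l) = a \<and> bheight (bs ! l) = Suc l \<and>
     bprev (bs ! l) = (if l = 0 then gen_hash X else hash X (bs ! (l - 1))))"

definition valid_lane :: "('s, 'h, 'x) execution \<Rightarrow> nat \<Rightarrow> ('s, 'h, 'x) block list \<Rightarrow> bool" where
  "valid_lane X a bs \<longleftrightarrow> hash_chain X a bs \<and> (\<forall>b\<in>set bs. block_ok X b)"

fun ends_at :: "('s, 'h, 'x) execution \<Rightarrow> ('s, 'h, 'x) block list \<Rightarrow> nat \<Rightarrow> 'h \<Rightarrow> bool" where
  "ends_at X bs k h \<longleftrightarrow> bs \<noteq> [] \<and> length bs = k \<and> hash X (last bs) = h"

text \<open>\<open>bs\<close> is the valid lane prefix named by the reference (unique, as the hash is injective).\<close>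

fun names :: "('s, 'h, 'x) execution \<Rightarrow> 'h ref \<Rightarrow> ('s, 'h, 'x) block list \<Rightarrow> bool" where
  "names X (a, k, h) bs \<longleftrightarrow> valid_lane X a bs \<and> ends_at X bs k h"

definition anc :: "('s, 'h, 'x) execution \<Rightarrow> 'h ref \<Rightarrow> ('s, 'h, 'x) block list \<Rightarrow> nat \<Rightarrow> 'h ref" where
  "anc X r bs l = (fst r, l, hash X (bs ! (l - 1)))"

fun strictly_contains :: "('s, 'h, 'x) execution \<Rightarrow> ('s, 'h, 'x) block list \<Rightarrow> nat \<times> 'h \<Rightarrow> bool" where
  "strictly_contains X bs (k, h) \<longleftrightarrow> 0 < k \<and> k < length bs \<and> hash X (bs ! (k - 1)) = h"

definition first_hand :: "('s, 'h, 'x) execution \<Rightarrow> nat \<Rightarrow> nat \<Rightarrow> ('s, 'h, 'x) block \<Rightarrow> bool" where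
  "first_hand X i m b \<longleftrightarrow> (\<exists>k<m. recv_at X k i (bauthor b) (Publish b))"

definition direct_pub :: "('s, 'h, 'x) execution \<Rightarrow> nat \<Rightarrow> nat \<Rightarrow> 'h ref \<Rightarrow> bool" where
  "direct_pub X i m r \<longleftrightarrow>
     (\<exists>bs. names X r bs \<and> set bs \<subseteq> store X i m \<and> (\<forall>b\<in>set bs. first_hand X i m b))"

text \<open>Least depth = greatest directly published ancestor; the predecessor walk is verified by
  holding the whole valid prefix named by the reference.\<close>

definition pub_depth :: "('s, 'h, 'x) execution \<Rightarrow> nat \<Rightarrow> nat \<Rightarrow> 'h ref \<Rightarrow> nat \<Rightarrow> bool" where
  "pub_depth X i m r d \<longleftrightarrow>
     (\<exists>bs. names X r bs \<and> set bs \<subseteq> store X i m \<and> 0 < d \<and> d < length bs \<and>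
           direct_pub X i m (anc X r bs (length bs - d)))"

definition claim_for :: "('s, 'h, 'x) execution \<Rightarrow> nat \<Rightarrow> nat \<Rightarrow> 'h ref \<Rightarrow> claim option" where
  "claim_for X i m r =
     (if direct_pub X i m r then Some Exact
      else if \<exists>d. pub_depth X i m r d then Some (Depth (LEAST d. pub_depth X i m r d))
      else None)"

definition claims_of :: "('s, 'h, 'x) execution \<Rightarrow> nat \<Rightarrow> nat \<Rightarrow> 'h proposal \<Rightarrow> 'h ref \<Rightarrow> claim option"
  where
  "claims_of X i m B r = (if r \<in> refs B then claim_for X i m r else None)"

definition echo_counted ::
  "('s, 'h, 'x) execution \<Rightarrow> nat \<Rightarrow> nat \<Rightarrow> nat \<Rightarrow> nat \<Rightarrow> grade \<Rightarrow> 'h proposal \<Rightarrow>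
     ('h ref \<Rightarrow> claim option) \<Rightarrow> bool" where
  "echo_counted X i m j v g B cl \<longleftrightarrow> (\<exists>w. first_recv X i m j (echo_stage v) (Echo v g B cl w))"

definition exact_ack :: "('s, 'h, 'x) execution \<Rightarrow> nat \<Rightarrow> nat \<Rightarrow> nat \<Rightarrow> 'h ref \<Rightarrow> bool" where
  "exact_ack X i m j r \<longleftrightarrow>
     (\<exists>v g B cl. echo_counted X i m j v g B cl \<and> r \<in> refs B \<and> cl r = Some Exact)"

text \<open>\<open>claim_height k c\<close> is the height up to which a claim on a reference of height \<open>k\<close>
  acknowledges its lane (0 for no acknowledgment).\<close>

fun claim_height :: "nat \<Rightarrow> claim option \<Rightarrow> nat" where
  "claim_height k None = 0"
| "claim_height k (Some Exact) = k"
| "claim_height k (Some (Depth d)) = (if 0 < d \<and> d < k then k - d else 0)"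

text \<open>Acknowledgments via a chain are counted from the first state \<open>m'\<close> on in which the chain
  is verified, and stay counted.\<close>

definition ack :: "('s, 'h, 'x) execution \<Rightarrow> nat \<Rightarrow> nat \<Rightarrow> nat \<Rightarrow> 'h ref \<Rightarrow> bool" where
  "ack X i m j r \<longleftrightarrow> exact_ack X i m j r \<or>
     (\<exists>m'\<le>m. \<exists>v g B cl r0 bs l. echo_counted X i m' j v g B cl \<and> r0 \<in> refs B \<and>
        names X r0 bs \<and> set bs \<subseteq> store X i m' \<and>
        1 \<le> l \<and> l \<le> claim_height (length bs) (cl r0) \<and> r = anc X r0 bs l)"

definition avail :: "('s, 'h, 'x) execution \<Rightarrow> nat \<Rightarrow> nat \<Rightarrow> nat \<Rightarrow> 'h ref \<Rightarrow> bool" where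
  "avail X i m q r \<longleftrightarrow> q \<le> card {j \<in> parties X. ack X i m j r}"

definition exact_avail :: "('s, 'h, 'x) execution \<Rightarrow> nat \<Rightarrow> nat \<Rightarrow> nat \<Rightarrow> 'h ref \<Rightarrow> bool" where
  "exact_avail X i m q r \<longleftrightarrow> q \<le> card {j \<in> parties X. exact_ack X i m j r}"

definition author_ok :: "('s, 'h, 'x) execution \<Rightarrow> nat \<Rightarrow> nat \<Rightarrow> 'h ref \<Rightarrow> bool" where
  "author_ok X i m r \<longleftrightarrow> direct_pub X i m r \<or> avail X i m (flt X + 1) r"

definition core_ok :: "('s, 'h, 'x) execution \<Rightarrow> nat \<Rightarrow> nat \<Rightarrow> 'h manifest \<Rightarrow> bool" where
  "core_ok X i m C \<longleftrightarrow> (\<forall>r\<in>mrefs C. author_ok X i m r)"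

definition tip_ok :: "('s, 'h, 'x) execution \<Rightarrow> nat \<Rightarrow> nat \<Rightarrow> 'h manifest \<Rightarrow> 'h manifest \<Rightarrow> bool" where
  "tip_ok X i m C T \<longleftrightarrow> (\<forall>r\<in>mrefs T. author_ok X i m r) \<and>
     (\<forall>a k h e. T a = Some (k, h) \<and> C a = Some e \<longrightarrow>
        (\<exists>bs. names X (a, k, h) bs \<and> set bs \<subseteq> store X i m \<and> strictly_contains X bs e))"

definition valid_manifest :: "('s, 'h, 'x) execution \<Rightarrow> 'h manifest \<Rightarrow> bool" where
  "valid_manifest X M \<longleftrightarrow>
     (\<forall>(a, k, h)\<in>mrefs M. \<exists>bs. hash_chain X a bs \<and> ends_at X bs k h \<and> (\<forall>b\<in>set bs. block_ok X b))"

text \<open>From state \<open>m\<close> on; "permanently" ranges over all later states.\<close>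

definition author_backed :: "('s, 'h, 'x) execution \<Rightarrow> nat \<Rightarrow> 'h manifest \<Rightarrow> bool" where
  "author_backed X m M \<longleftrightarrow>
     (\<forall>r\<in>mrefs M. \<exists>j\<in>correct X. \<exists>bs. names X r bs \<and> (\<forall>m'\<ge>m. set bs \<subseteq> store X j m') \<and>
        (\<forall>b\<in>set bs. \<exists>k<m. recv_at X k j (fst r) (Publish b)))"

definition retrievable :: "('s, 'h, 'x) execution \<Rightarrow> nat \<Rightarrow> 'h manifest \<Rightarrow> bool" where
  "retrievable X m M \<longleftrightarrow>
     (\<forall>r\<in>mrefs M. \<exists>j\<in>correct X. \<exists>bs. names X r bs \<and> (\<forall>m'\<ge>m. set bs \<subseteq> store X j m'))"

section \<open>Pacemaker\<close>

definition wish_seen :: "('s, 'h, 'x) execution \<Rightarrow> nat \<Rightarrow> nat \<Rightarrow> nat \<Rightarrow> nat" where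
  "wish_seen X i m j =
     Max (insert 0 {w. \<exists>k<m. \<exists>msg. recv_at X k i j msg \<and> wish_of msg = Some w})"

definition nth_wish :: "('s, 'h, 'x) execution \<Rightarrow> nat \<Rightarrow> nat \<Rightarrow> nat \<Rightarrow> nat" where
  "nth_wish X i m q = rev (sort (map (wish_seen X i m) [1..<Suc (num X)])) ! (q - 1)"

definition own_wish :: "('s, 'h, 'x) execution \<Rightarrow> nat \<Rightarrow> nat \<Rightarrow> nat" where
  "own_wish X i m =
     Max (insert 0 {w. \<exists>k<m. \<exists>msg. ev X k = Bcast i msg \<and> wish_of msg = Some w})"

text \<open>Genesis is the broadcast of WISH 2, required below to be a correct party's first event.\<close>

definition started :: "('s, 'h, 'x) execution \<Rightarrow> nat \<Rightarrow> nat \<Rightarrow> bool" where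
  "started X i m \<longleftrightarrow> sent X i m (\<lambda>msg. msg = Wish 2)"

definition entered :: "('s, 'h, 'x) execution \<Rightarrow> nat \<Rightarrow> nat \<Rightarrow> nat \<Rightarrow> bool" where
  "entered X i m v \<longleftrightarrow> 1 \<le> v \<and> started X i m \<and>
     (v = 1 \<or> (\<exists>m'\<le>m. v \<le> nth_wish X i m' (quorum X)))"

definition entry_time :: "('s, 'h, 'x) execution \<Rightarrow> nat \<Rightarrow> nat \<Rightarrow> real" where
  "entry_time X i v = now X (LEAST m. entered X i m v)"

definition fixed :: "('s, 'h, 'x) execution \<Rightarrow> nat \<Rightarrow> nat \<Rightarrow> nat \<Rightarrow> 'h proposal \<Rightarrow> bool" where
  "fixed X i m v B \<longleftrightarrow> first_recv X i m (proposer X v) (is_proposal v) (Proposal v B)"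

definition receipt_time :: "('s, 'h, 'x) execution \<Rightarrow> nat \<Rightarrow> nat \<Rightarrow> real" where
  "receipt_time X i v = now X (LEAST m. \<exists>B. fixed X i m v B)"

text \<open>The hashes of all entries of both manifests (tagged by manifest and author) are distinct.\<close>

definition well_formed :: "('s, 'h, 'x) execution \<Rightarrow> 'h proposal \<Rightarrow> bool" where
  "well_formed X B \<longleftrightarrow>
     dom (fst B) \<subseteq> parties X \<and> dom (snd B) \<subseteq> parties X \<and>
     (\<forall>(a, k, h)\<in>refs B. 0 < k) \<and>
     inj_on (\<lambda>(tip, a). snd (the ((if tip then snd B else fst B) a)))
       ({False} \<times> dom (fst B) \<union> {True} \<times> dom (snd B))"

text \<open>\<open>reaches X i m a\<close> iff the responsive frontier of \<open>i\<close> in state \<open>m\<close> is at least \<open>a\<close>.\<close>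

inductive reaches :: "('s, 'h, 'x) execution \<Rightarrow> nat \<Rightarrow> nat \<Rightarrow> nat \<Rightarrow> bool"
  for X :: "('s, 'h, 'x) execution" and i :: nat and m :: nat where
  initial: "reaches X i m 0"
| entry: "entered X i m v \<Longrightarrow> reaches X i m (v - 1)"
| advance: "reaches X i m a \<Longrightarrow> fixed X i m (Suc a) B \<Longrightarrow> well_formed X B \<Longrightarrow> reaches X i m (Suc a)"

definition activated :: "('s, 'h, 'x) execution \<Rightarrow> nat \<Rightarrow> nat \<Rightarrow> nat \<Rightarrow> bool" where
  "activated X i m v \<longleftrightarrow>
     (\<exists>a B. v = Suc a \<and> reaches X i m a \<and> fixed X i m v B \<and> well_formed X B)"

definition active :: "('s, 'h, 'x) execution \<Rightarrow> nat \<Rightarrow> nat \<Rightarrow> nat \<Rightarrow> 'h proposal \<Rightarrow> bool" where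
  "active X i m v B \<longleftrightarrow> fixed X i m v B \<and> well_formed X B \<and> (activated X i m v \<or> entered X i m v)"

text \<open>WISH carried by a response for view \<open>v\<close>: raised when the response completes the pair
  (echo stage of \<open>u - 1\<close>, ready stage of \<open>u - 2\<close>), to at least \<open>u + 1\<close>. Hence \<open>u = v + 1\<close> for
  echo-stage and \<open>u = v + 2\<close> for initial ready-stage responses; responses for view 0 count as
  given.\<close>

definition echo_wish :: "('s, 'h, 'x) execution \<Rightarrow> nat \<Rightarrow> nat \<Rightarrow> nat \<Rightarrow> nat" where
  "echo_wish X i m v =
     (if v \<le> 1 \<or> sent X i m (ready_stage (v - 1)) then max (own_wish X i m) (v + 2)
      else own_wish X i m)"

definition ready_wish :: "('s, 'h, 'x) execution \<Rightarrow> nat \<Rightarrow> nat \<Rightarrow> nat \<Rightarrow> nat" where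
  "ready_wish X i m v =
     (if sent X i m (echo_stage (v + 1)) then max (own_wish X i m) (v + 3) else own_wish X i m)"

section \<open>Direct AGB: tallies and results\<close>

definition echoes :: "('s, 'h, 'x) execution \<Rightarrow> nat \<Rightarrow> nat \<Rightarrow> nat \<Rightarrow> 'h proposal \<Rightarrow> nat set" where
  "echoes X i m v B = {j \<in> parties X. \<exists>g cl. echo_counted X i m j v g B cl}"

definition graded_echoes ::
  "('s, 'h, 'x) execution \<Rightarrow> nat \<Rightarrow> nat \<Rightarrow> nat \<Rightarrow> 'h proposal \<Rightarrow> grade \<Rightarrow> nat set" where
  "graded_echoes X i m v B g = {j \<in> parties X. \<exists>cl. echo_counted X i m j v g B cl}"

definition echo_responders :: "('s, 'h, 'x) execution \<Rightarrow> nat \<Rightarrow> nat \<Rightarrow> nat \<Rightarrow> nat set" where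
  "echo_responders X i m v = {j \<in> parties X. \<exists>msg. first_recv X i m j (echo_stage v) msg}"

definition readies :: "('s, 'h, 'x) execution \<Rightarrow> nat \<Rightarrow> nat \<Rightarrow> nat \<Rightarrow> 'h proposal \<Rightarrow> nat set" where
  "readies X i m v B =
     {j \<in> parties X. \<exists>rg w. first_recv X i m j (ready_stage v) (Ready v rg B w)}"

text \<open>Second disjunct: the first homogeneous READY for \<open>B\<close> after a first-counted READY-mix for
  \<open>B\<close> has grade \<open>g\<close>.\<close>

definition graded_readies ::
  "('s, 'h, 'x) execution \<Rightarrow> nat \<Rightarrow> nat \<Rightarrow> nat \<Rightarrow> 'h proposal \<Rightarrow> grade \<Rightarrow> nat set" where
  "graded_readies X i m v B g = {j \<in> parties X.
     (\<exists>w. first_recv X i m j (ready_stage v) (Ready v (Hom g) B w)) \<or>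
     (\<exists>k k' w w'. k < k' \<and> k' < m \<and> first_at X k i j (ready_stage v) (Ready v Mix B w) \<and>
        recv_at X k' i j (Ready v (Hom g) B w') \<and>
        (\<forall>l. k < l \<and> l < k' \<longrightarrow> (\<forall>g'' w''. \<not> recv_at X l i j (Ready v (Hom g'') B w''))))}"

definition completes :: "('s, 'h, 'x) execution \<Rightarrow> nat \<Rightarrow> nat \<Rightarrow> nat \<Rightarrow> 'h proposal \<Rightarrow> bool" where
  "completes X i m v B \<longleftrightarrow> quorum X \<le> card (readies X i m v B)"

definition hom_quorum ::
  "('s, 'h, 'x) execution \<Rightarrow> nat \<Rightarrow> nat \<Rightarrow> nat \<Rightarrow> 'h proposal \<Rightarrow> grade \<Rightarrow> bool" where
  "hom_quorum X i m v B g \<longleftrightarrow> quorum X \<le> card (graded_readies X i m v B g)"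

fun outcome_of :: "grade \<Rightarrow> 'h proposal \<Rightarrow> 'h outcome" where
  "outcome_of G1 (C, T) = CommitFull C T"
| "outcome_of G0 (C, T) = CommitCore C"

text \<open>Only the first homogeneous quorum of a view at a party yields a direct result.\<close>

definition direct_result :: "('s, 'h, 'x) execution \<Rightarrow> nat \<Rightarrow> nat \<Rightarrow> nat \<Rightarrow> 'h outcome \<Rightarrow> bool" where
  "direct_result X i m v out \<longleftrightarrow>
     (\<exists>m0\<le>m. \<exists>B g. hom_quorum X i m0 v B g \<and> (\<forall>m1<m0. \<forall>B' g'. \<not> hom_quorum X i m1 v B' g') \<and>
        out = outcome_of g B)"

definition fast_seals :: "('s, 'h, 'x) execution \<Rightarrow> nat \<Rightarrow> nat \<Rightarrow> nat \<Rightarrow> 'h outcome \<Rightarrow> bool" where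
  "fast_seals X i m v out \<longleftrightarrow>
     (\<exists>C T. (\<forall>j\<in>parties X. \<exists>cl. echo_counted X i m j v G1 (C, T) cl) \<and> out = CommitFull C T)"

definition sealed :: "('s, 'h, 'x) execution \<Rightarrow> nat \<Rightarrow> nat \<Rightarrow> nat \<Rightarrow> 'h outcome \<Rightarrow> bool" where
  "sealed X i m v out \<longleftrightarrow>
     direct_result X i m v out \<or> fast_seals X i m v out \<or> xseal X i m v out"

definition sealed_and_output :: "('s, 'h, 'x) execution \<Rightarrow> nat \<Rightarrow> nat \<Rightarrow> nat \<Rightarrow> bool" where
  "sealed_and_output X i m v \<longleftrightarrow>
     (\<exists>out. sealed X i m v out \<and>
        (\<forall>r\<in>payload out. \<exists>bs. names X r bs \<and> set bs \<subseteq> outp X i m))"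

section \<open>Block repair and storage\<close>

definition relied_refs :: "('s, 'h, 'x) execution \<Rightarrow> nat \<Rightarrow> nat \<Rightarrow> 'h ref set" where
  "relied_refs X i m =
     {r. \<exists>v B. fixed X i m v B \<and> well_formed X B \<and> r \<in> refs B} \<union>
     {r. \<exists>v B. completes X i m v B \<and> r \<in> refs B} \<union>
     {r. \<exists>v out. sealed X i m v out \<and> r \<in> payload out} \<union>
     {r. \<exists>j\<in>parties X. \<exists>v g B cl. echo_counted X i m j v g B cl \<and> r \<in> refs B \<and> cl r \<noteq> None}"

inductive wanted :: "('s, 'h, 'x) execution \<Rightarrow> nat \<Rightarrow> nat \<Rightarrow> 'h \<Rightarrow> bool"
  for X :: "('s, 'h, 'x) execution" and i :: nat and m :: nat where
  root: "(a, k, h) \<in> relied_refs X i m \<Longrightarrow> wanted X i m h"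
| pred: "wanted X i m (hash X b) \<Longrightarrow> b \<in> store X i m \<Longrightarrow> bprev b \<noteq> gen_hash X \<Longrightarrow>
           wanted X i m (bprev b)"

definition request_pending :: "('s, 'h, 'x) execution \<Rightarrow> nat \<Rightarrow> nat \<Rightarrow> 'h \<Rightarrow> bool" where
  "request_pending X i m h \<longleftrightarrow>
     started X i m \<and> wanted X i m h \<and> h \<notin> hash X ` store X i m \<and> \<not> sent X i m (\<lambda>msg. msg = Request h)"

definition serve_pending :: "('s, 'h, 'x) execution \<Rightarrow> nat \<Rightarrow> nat \<Rightarrow> nat \<Rightarrow> ('s, 'h, 'x) block \<Rightarrow> bool" where
  "serve_pending X i m j b \<longleftrightarrow>
     b \<in> store X i m \<and> (\<exists>k<m. recv_at X k i j (Request (hash X b))) \<and>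
     (\<forall>k<m. ev X k \<noteq> Send i j (Repair b))"

text \<open>What a correct party holds. Blocks enter the store only by being received. First-hand blocks
  (the only ones that can support a \<open>direct_pub\<close> check or an acknowledgment) and blocks on lanes
  relied on are kept for ever; other blocks may be dropped.\<close>

definition storage_ok :: "('s, 'h, 'x) execution \<Rightarrow> nat \<Rightarrow> bool" where
  "storage_ok X i \<longleftrightarrow> store X i 0 = {} \<and>
     (\<forall>m. store X i (Suc m) \<subseteq>
            store X i m \<union> {b. \<exists>j. recv_at X m i j (Publish b) \<or> recv_at X m i j (Repair b)}) \<and>
     (\<forall>m b. data_block X b \<and> block_ok X b \<and>
        (recv_at X m i (bauthor b) (Publish b) \<or>
         ((\<exists>j. recv_at X m i j (Repair b)) \<and> wanted X i m (hash X b)) \<or>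
         (b \<in> store X i m \<and> (first_hand X i m b \<or> wanted X i m (hash X b))))
        \<longrightarrow> b \<in> store X i (Suc m))"

section \<open>Vantage proposer policy\<close>

fun newest :: "(nat \<times> 'h::linorder) set \<Rightarrow> nat \<times> 'h \<Rightarrow> bool" where
  "newest S (k, h) \<longleftrightarrow> (k, h) \<in> S \<and> (\<forall>(k', h')\<in>S. k' < k \<or> (k' = k \<and> h \<le> h'))"

definition core_cands :: "('s, 'h, 'x) execution \<Rightarrow> nat \<Rightarrow> nat \<Rightarrow> nat \<Rightarrow> (nat \<times> 'h) set" where
  "core_cands X i m a =
     {(k, h). direct_pub X i m (a, k, h) \<and> exact_avail X i m (quorum X) (a, k, h)}"

definition core_policy :: "('s, 'h::linorder, 'x) execution \<Rightarrow> nat \<Rightarrow> nat \<Rightarrow> 'h manifest \<Rightarrow> bool" where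
  "core_policy X i m C \<longleftrightarrow> dom C \<subseteq> parties X \<and>
     (\<forall>a\<in>parties X. case C a of None \<Rightarrow> core_cands X i m a = {}
                              | Some e \<Rightarrow> newest (core_cands X i m a) e)"

definition tip_cands ::
  "('s, 'h, 'x) execution \<Rightarrow> nat \<Rightarrow> nat \<Rightarrow> 'h manifest \<Rightarrow> 'h manifest \<Rightarrow> nat \<Rightarrow> (nat \<times> 'h) set" where
  "tip_cands X i m C T a =
     {(k, h). direct_pub X i m (a, k, h) \<and>
        (\<exists>bs. names X (a, k, h) bs \<and> (\<forall>e. C a = Some e \<longrightarrow> strictly_contains X bs e)) \<and>
        (\<forall>a'<a. \<forall>k'. C a' \<noteq> Some (k', h) \<and> T a' \<noteq> Some (k', h))}"

definition partial_tip_cands ::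
  "('s, 'h, 'x) execution \<Rightarrow> nat \<Rightarrow> nat \<Rightarrow> 'h manifest \<Rightarrow> 'h manifest \<Rightarrow> nat \<Rightarrow> (nat \<times> 'h) set" where
  "partial_tip_cands X i m C T a =
     {(k, h) \<in> tip_cands X i m C T a.
        avail X i m (quorum X) (a, k, h) \<and> \<not> exact_avail X i m (quorum X) (a, k, h)}"

definition tip_entry ::
  "('s, 'h::linorder, 'x) execution \<Rightarrow> nat \<Rightarrow> nat \<Rightarrow> 'h manifest \<Rightarrow> 'h manifest \<Rightarrow> nat \<Rightarrow> bool" where
  "tip_entry X i m C T a \<longleftrightarrow>
     (case T a of
        None \<Rightarrow> tip_cands X i m C T a = {}
      | Some e \<Rightarrow>
          if partial_tip_cands X i m C T a \<noteq> {}
          then e \<in> partial_tip_cands X i m C T a \<and>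
               (\<forall>e'\<in>partial_tip_cands X i m C T a. fst e \<le> fst e')
          else newest (tip_cands X i m C T a) e)"

text \<open>Quarantine. A slot holds the stored (height, hash), the ordinal of the own proposer turn
  from which the author is due for a retry, and the current gap. An insertion makes the author due
  one turn later; each retry doubles the gap.\<close>

type_synonym 'h slot = "(nat \<times> 'h) \<times> nat \<times> nat"

definition turns :: "('s, 'h, 'x) execution \<Rightarrow> nat \<Rightarrow> nat \<Rightarrow> nat" where
  "turns X i m = card {k. k < m \<and> (\<exists>v B. ev X k = Bcast i (Proposal v B))}"

definition quar_turn ::
  "('s, 'h, 'x) execution \<Rightarrow> nat \<Rightarrow> nat \<Rightarrow> (nat \<Rightarrow> 'h slot option) \<Rightarrow> nat \<Rightarrow> 'h slot option" where
  "quar_turn X i m q a =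
     (case q a of
        None \<Rightarrow> None
      | Some (e, due, gap) \<Rightarrow>
          if \<exists>v B. ev X m = Bcast i (Proposal v B) \<and> a \<in> dom (snd B)
          then Some (e, Suc (turns X i m) + 2 * gap, 2 * gap)
          else Some (e, due, gap))"

definition newly_quarantined :: "('s, 'h, 'x) execution \<Rightarrow> nat \<Rightarrow> nat \<Rightarrow> nat \<Rightarrow> (nat \<times> 'h) set" where
  "newly_quarantined X i m a =
     {(k, h). \<exists>v C T. completes X i (Suc m) v (C, T) \<and> \<not> completes X i m v (C, T) \<and>
        (\<forall>g. \<not> hom_quorum X i (Suc m) v (C, T) g) \<and> T a = Some (k, h) \<and>
        \<not> exact_avail X i (Suc m) (quorum X) (a, k, h)}"

definition quar_insert ::
  "('s, 'h, 'x) execution \<Rightarrow> nat \<Rightarrow> nat \<Rightarrow> (nat \<Rightarrow> 'h slot option) \<Rightarrow> nat \<Rightarrow> 'h slot option" where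
  "quar_insert X i m q a =
     (if q a = None \<and> newly_quarantined X i m a \<noteq> {}
      then Some (SOME e. e \<in> newly_quarantined X i m a, Suc (turns X i (Suc m)), 1)
      else q a)"

definition quar_clear ::
  "('s, 'h, 'x) execution \<Rightarrow> nat \<Rightarrow> nat \<Rightarrow> (nat \<Rightarrow> 'h slot option) \<Rightarrow> nat \<Rightarrow> 'h slot option" where
  "quar_clear X i m q a =
     (case q a of
        None \<Rightarrow> None
      | Some (e, due, gap) \<Rightarrow>
          if exact_avail X i m (quorum X) (a, e) \<or>
             (\<exists>c\<in>core_cands X i m a. \<exists>bs. names X (a, c) bs \<and> (c = e \<or> strictly_contains X bs e))
          then None else q a)"

primrec quar :: "('s, 'h, 'x) execution \<Rightarrow> nat \<Rightarrow> nat \<Rightarrow> nat \<Rightarrow> 'h slot option" where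
  "quar X i 0 = (\<lambda>a. None)"
| "quar X i (Suc m) =
     quar_clear X i (Suc m) (quar_insert X i m (quar_turn X i m (quar X i m)))"

definition due :: "('s, 'h, 'x) execution \<Rightarrow> nat \<Rightarrow> nat \<Rightarrow> nat \<Rightarrow> bool" where
  "due X i m a \<longleftrightarrow> (\<exists>e d gap. quar X i m a = Some (e, d, gap) \<and> d \<le> Suc (turns X i m))"

text \<open>The optional author \<open>\<rho>\<close> is the one quarantined author retried in this proposal.\<close>

definition tip_policy ::
  "('s, 'h::linorder, 'x) execution \<Rightarrow> nat \<Rightarrow> nat \<Rightarrow> 'h manifest \<Rightarrow> 'h manifest \<Rightarrow> bool" where
  "tip_policy X i m C T \<longleftrightarrow> dom T \<subseteq> parties X \<and>
     (\<exists>\<rho>. \<forall>a\<in>parties X.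
        if quar X i m a = None \<or> (\<rho> = Some a \<and> due X i m a) then tip_entry X i m C T a
        else T a = None)"

section \<open>Protocol rules\<close>

datatype rule = Genesis | RaiseWish | Propose nat | EchoFull nat | SendReady nat | Refine nat

definition echo_full_rule :: "('s, 'h, 'x) execution \<Rightarrow> nat \<Rightarrow> nat \<Rightarrow> nat \<Rightarrow> 'h proposal \<Rightarrow> bool" where
  "echo_full_rule X i m v B \<longleftrightarrow> 1 \<le> v \<and> \<not> sent X i m (echo_stage v) \<and> active X i m v B \<and>
     core_ok X i m (fst B) \<and> tip_ok X i m (fst B) (snd B)"

definition propose_rule :: "('s, 'h, 'x) execution \<Rightarrow> nat \<Rightarrow> nat \<Rightarrow> nat \<Rightarrow> bool" where
  "propose_rule X i m v \<longleftrightarrow> 1 \<le> v \<and> i = proposer X v \<and> started X i m \<and>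
     \<not> sent X i m (is_proposal v) \<and> (reaches X i m (v - 1) \<or> v \<le> nth_wish X i m (flt X + 1))"

definition ready_rule :: "('s, 'h, 'x) execution \<Rightarrow> nat \<Rightarrow> nat \<Rightarrow> nat \<Rightarrow> 'h proposal \<Rightarrow> bool" where
  "ready_rule X i m v B \<longleftrightarrow> 1 \<le> v \<and> started X i m \<and> \<not> sent X i m (ready_stage v) \<and>
     quorum X \<le> card (echoes X i m v B)"

definition initial_ready_grade :: "('s, 'h, 'x) execution \<Rightarrow> nat \<Rightarrow> nat \<Rightarrow> nat \<Rightarrow> 'h proposal \<Rightarrow> ready_grade"
  where
  "initial_ready_grade X i m v B =
     (if quorum X \<le> card (graded_echoes X i m v B G1) then Hom G1
      else if quorum X \<le> card (graded_echoes X i m v B G0) then Hom G0 else Mix)"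

definition refine_rule ::
  "('s, 'h, 'x) execution \<Rightarrow> nat \<Rightarrow> nat \<Rightarrow> real \<Rightarrow> nat \<Rightarrow> 'h proposal \<Rightarrow> grade \<Rightarrow> bool" where
  "refine_rule X i m t v B g \<longleftrightarrow>
     sent X i m (\<lambda>msg. \<exists>w. msg = Ready v Mix B w) \<and>
     \<not> sent X i m (\<lambda>msg. \<exists>g' B' w. msg = Ready v (Hom g') B' w) \<and>
     echo_responders X i m v \<noteq> parties X \<and>
     (entered X i m v \<longrightarrow> clk X i t < clk X i (entry_time X i v) + 4 * Delta X) \<and>
     quorum X \<le> card (graded_echoes X i m v B g)"

text \<open>The positive (not timeout-driven) rules that are enabled at party \<open>i\<close> in state \<open>m\<close>.\<close>

fun enabled :: "('s, 'h, 'x) execution \<Rightarrow> nat \<Rightarrow> nat \<Rightarrow> rule \<Rightarrow> bool" where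
  "enabled X i m Genesis \<longleftrightarrow> \<not> started X i m"
| "enabled X i m RaiseWish \<longleftrightarrow> started X i m \<and> own_wish X i m < nth_wish X i m (flt X + 1)"
| "enabled X i m (Propose v) \<longleftrightarrow> propose_rule X i m v"
| "enabled X i m (EchoFull v) \<longleftrightarrow> (\<exists>B. echo_full_rule X i m v B)"
| "enabled X i m (SendReady v) \<longleftrightarrow> (\<exists>B. ready_rule X i m v B)"
| "enabled X i m (Refine v) \<longleftrightarrow> (\<exists>B g. refine_rule X i m (now X m) v B g)"

text \<open>Deadlines are values of the local clock of \<open>i\<close>.\<close>

definition window_end :: "('s, 'h, 'x) execution \<Rightarrow> nat \<Rightarrow> nat \<Rightarrow> real" where
  "window_end X i v =
     min (max (clk X i (entry_time X i v)) (clk X i (receipt_time X i v)) + Delta X)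
         (clk X i (entry_time X i v) + 3 * Delta X)"

definition echo_deadline :: "('s, 'h, 'x) execution \<Rightarrow> nat \<Rightarrow> nat \<Rightarrow> nat \<Rightarrow> real" where
  "echo_deadline X i m v =
     (if \<exists>B. active X i m v B then window_end X i v else clk X i (entry_time X i v) + 3 * Delta X)"

definition ready_deadline :: "('s, 'h, 'x) execution \<Rightarrow> nat \<Rightarrow> nat \<Rightarrow> real" where
  "ready_deadline X i v = clk X i (entry_time X i v) + 4 * Delta X"

text \<open>Event \<open>m\<close> may be a timeout of \<open>i\<close> for local deadline \<open>D\<close>: every message delivered by \<open>D\<close>
  has been processed before, and no positive rule is left enabled.\<close>

definition timeout :: "('s, 'h, 'x) execution \<Rightarrow> nat \<Rightarrow> nat \<Rightarrow> real \<Rightarrow> bool" where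
  "timeout X i m D \<longleftrightarrow> D \<le> clk X i (tm X m) \<and>
     (\<forall>k>m. \<forall>j msg. ev X k = Deliver j i msg \<longrightarrow> D < clk X i (tm X k)) \<and>
     (\<forall>\<rho>. \<not> enabled X i m \<rho>)"

text \<open>Which broadcasts a correct party \<open>i\<close> may perform as event \<open>m\<close>.\<close>

fun bcast_ok :: "('s, 'h::linorder, 'x) execution \<Rightarrow> nat \<Rightarrow> nat \<Rightarrow> ('s, 'h, 'x) msg \<Rightarrow> bool" where
  "bcast_ok X m i (Publish b) \<longleftrightarrow> started X i m \<and>
     (\<exists>bs. valid_lane X i (bs @ [b]) \<and> set bs = {b'. \<exists>k<m. ev X k = Bcast i (Publish b')})"
| "bcast_ok X m i (Request h) \<longleftrightarrow> request_pending X i m h"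
| "bcast_ok X m i (Repair b) \<longleftrightarrow> False"
| "bcast_ok X m i (Proposal v B) \<longleftrightarrow> propose_rule X i m v \<and>
     core_policy X i m (fst B) \<and> tip_policy X i m (fst B) (snd B)"
| "bcast_ok X m i (Echo v g B cl w) \<longleftrightarrow>
     cl = claims_of X i m B \<and> w = echo_wish X i m v \<and>
     (case g of
        G1 \<Rightarrow> echo_full_rule X i m v B
      | G0 \<Rightarrow> 1 \<le> v \<and> \<not> sent X i m (echo_stage v) \<and> entered X i m v \<and> active X i m v B \<and>
             timeout X i m (window_end X i v) \<and> core_ok X i m (fst B))"
| "bcast_ok X m i (EchoSkip v w) \<longleftrightarrow>
     w = echo_wish X i m v \<and> \<not> sent X i m (echo_stage v) \<and> entered X i m v \<and>
     timeout X i m (echo_deadline X i m v) \<and>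
     (\<forall>B. active X i m v B \<longrightarrow> \<not> core_ok X i m (fst B))"
| "bcast_ok X m i (Ready v rg B w) \<longleftrightarrow>
     (ready_rule X i m v B \<and> rg = initial_ready_grade X i m v B \<and> w = ready_wish X i m v) \<or>
     (\<exists>g. rg = Hom g \<and> refine_rule X i m (tm X m) v B g \<and> w = own_wish X i m)"
| "bcast_ok X m i (NoReady v w) \<longleftrightarrow>
     w = ready_wish X i m v \<and> \<not> sent X i m (ready_stage v) \<and> entered X i m v \<and>
     timeout X i m (ready_deadline X i v)"
| "bcast_ok X m i (Wish w) \<longleftrightarrow>
     (if started X i m then own_wish X i m < w \<and> w = nth_wish X i m (flt X + 1) else w = 2)"

text \<open>Channels are authenticated: a delivery from a correct sender needs an earlier matching send;
  Byzantine senders can have anything delivered in their own name.\<close>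

fun event_ok :: "('s, 'h::linorder, 'x) execution \<Rightarrow> nat \<Rightarrow> ('s, 'h, 'x) event \<Rightarrow> bool" where
  "event_ok X m (Bcast i msg) \<longleftrightarrow> i \<in> parties X \<and> (i \<in> correct X \<longrightarrow> bcast_ok X m i msg)"
| "event_ok X m (Send i j msg) \<longleftrightarrow> i \<in> parties X \<and> j \<in> parties X \<and>
     (i \<in> correct X \<longrightarrow> (\<exists>b. msg = Repair b \<and> serve_pending X i m j b))"
| "event_ok X m (Deliver j i msg) \<longleftrightarrow> i \<in> parties X \<and> j \<in> parties X \<and>
     (i \<in> correct X \<longrightarrow> started X i m) \<and>
     (j \<in> correct X \<longrightarrow> (\<exists>k<m. ev X k = Bcast j msg \<or> ev X k = Send j i msg))"
| "event_ok X m Idle \<longleftrightarrow> True"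

text \<open>Fairness without time bounds: eventual delivery between correct parties, no positive rule,
  request or service stays enabled for ever, and expired timers are eventually acted upon.\<close>

definition fair :: "('s, 'h, 'x) execution \<Rightarrow> bool" where
  "fair X \<longleftrightarrow>
     (\<forall>i\<in>correct X. \<forall>j\<in>correct X. \<forall>k msg.
        ev X k = Bcast i msg \<or> ev X k = Send i j msg \<longrightarrow> (\<exists>k'\<ge>k. recv_at X k' j i msg)) \<and>
     (\<forall>i\<in>correct X. \<forall>m \<rho>. enabled X i m \<rho> \<longrightarrow> (\<exists>k\<ge>m. \<not> enabled X i k \<rho>)) \<and>
     (\<forall>i\<in>correct X. \<forall>m h. request_pending X i m h \<longrightarrow> (\<exists>k\<ge>m. \<not> request_pending X i k h)) \<and>
     (\<forall>i\<in>correct X. \<forall>j\<in>correct X. \<forall>m b.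
        serve_pending X i m j b \<longrightarrow> (\<exists>k\<ge>m. \<not> serve_pending X i k j b)) \<and>
     (\<forall>i\<in>correct X. \<forall>v m t. entered X i m v \<and> now X m \<le> t \<and> echo_deadline X i m v \<le> clk X i t
        \<longrightarrow> (\<exists>k. sent X i k (echo_stage v))) \<and>
     (\<forall>i\<in>correct X. \<forall>v m t. entered X i m v \<and> now X m \<le> t \<and> ready_deadline X i v \<le> clk X i t
        \<longrightarrow> (\<exists>k. sent X i k (ready_stage v)))"

text \<open>The protocol model without any timing assumption: local clocks are merely monotone, and
  \<open>gst\<close> and \<open>delta\<close> play no role.\<close>

definition vantage_execution :: "('s, 'h::linorder, 'x) execution \<Rightarrow> bool" where
  "vantage_execution X \<longleftrightarrow>
     num X \<ge> 3 * flt X + 1 \<and> byz X \<subseteq> parties X \<and> card (byz X) \<le> flt X \<and> 0 < Delta X \<and>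
     inj (hash X) \<and> gen_hash X \<notin> range (hash X) \<and>
     (\<forall>k. 0 \<le> tm X k) \<and> mono (tm X) \<and> (\<forall>t. \<exists>k. t < tm X k) \<and>
     (\<forall>i\<in>correct X. mono (clk X i)) \<and>
     (\<forall>m. event_ok X m (ev X m)) \<and>
     (\<forall>i\<in>correct X. storage_ok X i) \<and>
     (\<forall>i\<in>correct X. \<forall>m. outp X i (Suc m) \<subseteq> outp X i m \<union> store X i (Suc m)) \<and>
     (\<forall>i\<in>correct X. outp X i 0 = {}) \<and>
     fair X"

text \<open>Partial synchrony: message bound, drift-free clocks after GST, and, after GST, immediate
  local reactions ("as soon as") and timers that expire exactly at their deadline. That a timer of
  duration \<open>\<theta>\<close> armed before GST expires by \<open>gst + \<theta>\<close> follows from the clock conditions.\<close>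

definition partially_synchronous :: "('s, 'h, 'x) execution \<Rightarrow> bool" where
  "partially_synchronous X \<longleftrightarrow>
     0 \<le> gst X \<and> 0 < delta X \<and> delta X \<le> Delta X \<and>
     (\<forall>i\<in>correct X. \<forall>j\<in>correct X. \<forall>k msg.
        ev X k = Bcast i msg \<or> ev X k = Send i j msg \<longrightarrow>
        (\<exists>k'\<ge>k. recv_at X k' j i msg \<and> tm X k' \<le> max (tm X k) (gst X) + delta X)) \<and>
     (\<forall>i\<in>correct X. \<forall>t t'. gst X \<le> t \<and> t \<le> t' \<longrightarrow> clk X i t' - clk X i t = t' - t) \<and>
     (\<forall>i\<in>correct X. \<forall>m \<rho>. enabled X i m \<rho> \<longrightarrow>
        (\<exists>k\<ge>m. \<not> enabled X i k \<rho> \<and> now X k \<le> max (now X m) (gst X))) \<and>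
     (\<forall>i\<in>correct X. \<forall>v m t. entered X i m v \<and> now X m \<le> t \<and> echo_deadline X i m v \<le> clk X i t
        \<longrightarrow> by_time X (max t (gst X)) (\<lambda>k. sent X i k (echo_stage v))) \<and>
     (\<forall>i\<in>correct X. \<forall>v m t. entered X i m v \<and> now X m \<le> t \<and> ready_deadline X i v \<le> clk X i t
        \<longrightarrow> by_time X (max t (gst X)) (\<lambda>k. sent X i k (ready_stage v)))"

section \<open>Notions used in the claim\<close>

definition proposed_at :: "('s, 'h, 'x) execution \<Rightarrow> nat \<Rightarrow> 'h proposal \<Rightarrow> real \<Rightarrow> bool" where
  "proposed_at X v B t \<longleftrightarrow> (\<exists>k. ev X k = Bcast (proposer X v) (Proposal v B) \<and> tm X k = t)"

definition first_entry :: "('s, 'h, 'x) execution \<Rightarrow> nat \<Rightarrow> real \<Rightarrow> bool" where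
  "first_entry X v s \<longleftrightarrow>
     (\<exists>i\<in>correct X. \<exists>m. entered X i m v \<and> now X m = s) \<and>
     (\<forall>i\<in>correct X. \<forall>m. entered X i m v \<longrightarrow> s \<le> now X m)"

definition pacemaker_cutoff :: "('s, 'h, 'x) execution \<Rightarrow> nat \<Rightarrow> bool" where
  "pacemaker_cutoff X c \<longleftrightarrow>
     (\<forall>v>c. \<exists>s. first_entry X v s \<and> gst X \<le> s \<and>
        (\<forall>i\<in>correct X. by_time X (s + 2 * delta X) (\<lambda>m. entered X i m v)) \<and>
        (proposer X v \<in> correct X \<longrightarrow>
           (\<exists>B t. proposed_at X v B t \<and> well_formed X B \<and> gst X \<le> t \<and> t \<le> s + delta X)))"

definition all_correct_cutoff :: "('s, 'h, 'x) execution \<Rightarrow> nat \<Rightarrow> bool" where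
  "all_correct_cutoff X c \<longleftrightarrow> byz X = {} \<and> pacemaker_cutoff X c \<and>
     (\<forall>v>c. \<forall>s. first_entry X v s \<longrightarrow>
        (\<forall>i\<in>parties X. by_time X (s + delta X) (\<lambda>m. entered X i m v)))"

definition prefix_extending :: "('s, 'h, 'x) execution \<Rightarrow> nat \<Rightarrow> real \<Rightarrow> bool" where
  "prefix_extending X v \<beta> \<longleftrightarrow> (\<forall>u. 1 \<le> u \<and> u < v \<longrightarrow> (\<exists>B t. proposed_at X u B t \<and> t \<le> \<beta>))"

definition all_correct_responsive_suffix :: "('s, 'h, 'x) execution \<Rightarrow> nat \<Rightarrow> bool" where
  "all_correct_responsive_suffix X r \<longleftrightarrow>
     byz X = {} \<and> (\<exists>c<r. all_correct_cutoff X c) \<and>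
     (\<exists>B \<beta>. proposed_at X r B \<beta> \<and> prefix_extending X r \<beta> \<and>
        (\<forall>u. 1 \<le> u \<and> u < r \<longrightarrow>
           (\<forall>i\<in>parties X. by_time X \<beta> (\<lambda>m. sealed_and_output X i m u))))"

text \<open>The direct result names the payload of the proposal.\<close>

fun names_payload :: "'h outcome \<Rightarrow> 'h proposal \<Rightarrow> bool" where
  "names_payload (CommitFull C T) B \<longleftrightarrow> B = (C, T)"
| "names_payload (CommitCore C) B \<longleftrightarrow> fst B = C"
| "names_payload CommitNone B \<longleftrightarrow> False"

end

theory Submission
  imports Defs
begin

text \<open>Any two quorums share a correct party, and a correct party names one proposal in all its
  READY statements of a view and sends at most one homogeneous READY; this gives agreement. A
  completed core passed the core check of a correct echoer, and either alternative of that check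
  leads to a correct party holding the lane first-hand.

  For the timing claims, a timeout can fire only after everything delivered by the local deadline
  has been processed. The echo deadline lies at least \<open>\<delta>\<close> after the proposal was sent, and the
  ready deadline at least \<open>\<delta>\<close> after the last correct echo, so in a synchronous view with a correct
  proposer a timeout cannot hit a party that has not yet heard what it needs. When all parties are
  correct, \<open>\<delta>\<close> after the proposal each party has heard the direct publications behind all its
  references and the proposals of all lower views, so everybody echoes with grade 1.\<close>

locale vantage =
  fixes X :: "('s, 'h::linorder, 'x) execution"
  assumes exec: "vantage_execution X"
begin

section \<open>Quorums\<close>

lemma finite_parties: "finite (parties X)"
  and card_parties: "card (parties X) = num X"
  by (simp_all add: parties_def)

lemma correct_party: "i \<in> correct X \<Longrightarrow> i \<in> parties X"
  by (simp add: correct_def)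

lemma card_byz: "card (byz X) \<le> flt X" and byz_subset: "byz X \<subseteq> parties X"
  and size: "num X \<ge> 3 * flt X + 1"
  using exec by (auto simp: vantage_execution_def)

lemma quorum_gt: "flt X < quorum X"
  using size by (simp add: quorum_def)

lemma quorum_le_card_correct: "quorum X \<le> card (correct X)"
  unfolding correct_def quorum_def
  using card_Diff_subset[OF finite_subset[OF byz_subset finite_parties] byz_subset]
    card_byz card_parties by linarith

lemma correct_in_large:
  assumes "A \<subseteq> parties X" "flt X < card A"
  shows "\<exists>p\<in>A. p \<in> correct X"
proof (rule ccontr)
  assume "\<not> ?thesis"
  then have "A \<subseteq> byz X"
    using assms(1) by (auto simp: correct_def)
  then have "card A \<le> card (byz X)"
    by (meson byz_subset card_mono finite_parties finite_subset)
  then show False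
    using card_byz assms(2) by linarith
qed

lemma correct_in_quorum:
  assumes "A \<subseteq> parties X" "quorum X \<le> card A"
  shows "\<exists>p\<in>A. p \<in> correct X"
  using correct_in_large[OF assms(1)] assms(2) quorum_gt by linarith

text \<open>By inclusion-exclusion the overlap has at least
  \<open>2 * (n - f) - n = n - 2 * f > f\<close> members, too many for all of them to be
  Byzantine.\<close>

lemma quorums_intersect:
  assumes "A \<subseteq> parties X" "quorum X \<le> card A" "B \<subseteq> parties X" "quorum X \<le> card B"
  shows "\<exists>p. p \<in> A \<and> p \<in> B \<and> p \<in> correct X"
proof -
  have fin: "finite A" "finite B"
    using assms finite_parties finite_subset by blast+
  have "card (A \<union> B) \<le> num X"
    using assms(1,3) card_mono[OF finite_parties, of "A \<union> B"] card_parties by auto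
  then have "flt X < card (A \<inter> B)"
    using card_Un_Int[OF fin] assms(2,4) size by (simp add: quorum_def)
  then show ?thesis
    using correct_in_large[of "A \<inter> B"] assms(1) by blast
qed

lemma quorum_if_correct_subset:
  assumes "correct X \<subseteq> A" "A \<subseteq> parties X"
  shows "quorum X \<le> card A"
  using card_mono[OF finite_subset[OF assms(2) finite_parties] assms(1)] quorum_le_card_correct
  by linarith

section \<open>Channels\<close>

lemma event: "event_ok X m (ev X m)"
  using exec by (simp add: vantage_execution_def)

lemma bcast: "ev X m = Bcast i msg \<Longrightarrow> i \<in> correct X \<Longrightarrow> bcast_ok X m i msg"
  using event[of m] by simp

text \<open>A correct party uses the point-to-point \<open>Send\<close> only for
  \<open>Repair\<close>. The bound is \<open>l \<le> k\<close> and not \<open>l < k\<close> because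
  a broadcast reaches its own sender at the very same event.\<close>

lemma recv_bcast:
  assumes "recv_at X k i j msg" "j \<in> correct X" "\<And>b. msg \<noteq> Repair b"
  shows "\<exists>l\<le>k. ev X l = Bcast j msg"
proof (cases "ev X k = Deliver j i msg")
  case True
  then obtain l where "l < k" and l: "ev X l = Bcast j msg \<or> ev X l = Send j i msg"
    using event[of k] assms(2) by auto
  moreover have "ev X l \<noteq> Send j i msg"
    using event[of l] assms(2,3) by auto
  ultimately show ?thesis
    by (meson less_imp_le)
next
  case False
  then show ?thesis
    using assms(1) by (auto simp: recv_at_def)
qed

lemma first_recvD:
  assumes "first_recv X i m j P msg"
  shows "P msg" and "\<exists>k<m. recv_at X k i j msg"
  using assms by (auto simp: first_recv_def first_at_def)

lemma first_recv_mono: "first_recv X i m j P msg \<Longrightarrow> m \<le> m' \<Longrightarrow> first_recv X i m' j P msg"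
  unfolding first_recv_def using less_le_trans by blast

lemma first_recv_exists:
  assumes "recv_at X k i j msg" "P msg" "k < m"
  shows "\<exists>msg'. first_recv X i m j P msg'"
proof -
  define l where "l = (LEAST l. \<exists>msg'. recv_at X l i j msg' \<and> P msg')"
  have "\<exists>msg'. recv_at X l i j msg' \<and> P msg'"
    unfolding l_def by (rule LeastI) (use assms in blast)
  moreover have "l \<le> k"
    unfolding l_def by (rule Least_le) (use assms in blast)
  moreover have "\<And>l'. l' < l \<Longrightarrow> \<not> (\<exists>msg'. recv_at X l' i j msg' \<and> P msg')"
    unfolding l_def by (rule not_less_Least)
  ultimately show ?thesis
    using assms(3) unfolding first_recv_def first_at_def by (meson le_less_trans)
qed

lemma first_recv_bcast:
  assumes "first_recv X i m j P msg" "j \<in> correct X" "\<And>b. msg \<noteq> Repair b"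
  shows "\<exists>k<m. ev X k = Bcast j msg"
  using first_recvD(2)[OF assms(1)] recv_bcast[OF _ assms(2,3)] le_less_trans by meson

section \<open>Statements of correct parties\<close>

lemma sent_mono: "sent X i m P \<Longrightarrow> m \<le> m' \<Longrightarrow> sent X i m' P"
  unfolding sent_def using less_le_trans by blast

text \<open>Common pattern for once-per-view messages: a guard demanding that nothing of the kind
  was sent before excludes the later of two such broadcasts.\<close>

lemma bcast_unique:
  assumes "ev X k = Bcast i msg" "ev X k' = Bcast i msg'" "P msg" "P msg'"
    and "\<And>m msg. ev X m = Bcast i msg \<Longrightarrow> P msg \<Longrightarrow> \<not> sent X i m P"
  shows "k = k' \<and> msg = msg'"
proof -
  have "k = k'"
    using assms unfolding sent_def by (metis linorder_neqE_nat)
  then show ?thesis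
    using assms(1,2) by simp
qed

lemma echo_stage_bcast:
  assumes "i \<in> correct X" "ev X k = Bcast i msg" "echo_stage v msg"
  shows "\<not> sent X i k (echo_stage v)"
  using bcast[OF assms(2,1)] assms(3)
  by (cases msg) (auto simp: echo_full_rule_def split: grade.splits)

lemma echo_stage_unique:
  assumes "i \<in> correct X" "ev X k = Bcast i msg" "ev X k' = Bcast i msg'"
    "echo_stage v msg" "echo_stage v msg'"
  shows "k = k' \<and> msg = msg'"
  using bcast_unique[OF assms(2-5)] echo_stage_bcast[OF assms(1)] by blast

lemma proposal_unique:
  assumes "i \<in> correct X" "ev X k = Bcast i (Proposal v B)" "ev X k' = Bcast i (Proposal v B')"
  shows "k = k' \<and> B = B'"
proof -
  have "\<not> sent X i m (is_proposal v)" if "ev X m = Bcast i msg" "is_proposal v msg" for m msg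
    using bcast[OF that(1) assms(1)] that(2) by (cases msg) (auto simp: propose_rule_def)
  then show ?thesis
    using bcast_unique[OF assms(2,3), of "is_proposal v"] by simp
qed


lemma ready_cases:
  assumes "i \<in> correct X" "ev X k = Bcast i (Ready v rg B w)"
  obtains "ready_rule X i k v B" "rg = initial_ready_grade X i k v B"
  | g where "rg = Hom g" "refine_rule X i k (tm X k) v B g"
  using bcast[OF assms(2,1)] by auto

text \<open>A refinement repeats the proposal of an earlier mix READY. That one cannot be a
  refinement again, as refinements are homogeneous, so it comes from the initial rule.\<close>

lemma ready_origin:
  assumes "i \<in> correct X" "ev X k = Bcast i (Ready v rg B w)"
  shows "\<exists>l\<le>k. \<exists>rg' w'. ev X l = Bcast i (Ready v rg' B w') \<and> ready_rule X i l v B"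
  using assms
proof (cases rule: ready_cases)
  case 1
  then show ?thesis
    using assms(2) by blast
next
  case (2 g)
  then obtain l w' where l: "l < k" "ev X l = Bcast i (Ready v Mix B w')"
    by (auto simp: refine_rule_def sent_def)
  from assms(1) l(2) have "ready_rule X i l v B"
    by (cases rule: ready_cases) auto
  then show ?thesis
    using l less_imp_le by blast
qed

text \<open>Both READYs go back to initial ones for the same proposals, and the initial rule is
  blocked once any ready-stage statement of the view was sent.\<close>

lemma ready_unique:
  assumes "i \<in> correct X" "ev X k = Bcast i (Ready v rg B w)" "ev X k' = Bcast i (Ready v rg' B' w')"
  shows "B = B'"
proof -
  obtain l rg1 w1 where l: "ev X l = Bcast i (Ready v rg1 B w1)" "ready_rule X i l v B"
    using ready_origin[OF assms(1,2)] by blast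
  obtain l' rg2 w2 where l': "ev X l' = Bcast i (Ready v rg2 B' w2)" "ready_rule X i l' v B'"
    using ready_origin[OF assms(1,3)] by blast
  have "\<not> l < l'" "\<not> l' < l"
    using l l' unfolding ready_rule_def sent_def by (metis ready_stage.simps(1))+
  then show ?thesis
    using l(1) l'(1) by (cases l l' rule: linorder_cases) auto
qed

text \<open>One homogeneous READY blocks both ways to another: the initial rule wants no ready-stage
  statement before it, refinement wants no homogeneous one.\<close>

lemma hom_ready_unique:
  assumes "i \<in> correct X" "ev X k = Bcast i (Ready v (Hom g) B w)"
    "ev X k' = Bcast i (Ready v (Hom g') B' w')"
  shows "g = g'"
proof -
  have later: False if lt: "l < l'" and l: "ev X l = Bcast i (Ready v (Hom h) B1 w1)"
    and l': "ev X l' = Bcast i (Ready v (Hom h') B2 w2)" for l l' h h' B1 B2 w1 w2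
  proof -
    have s: "sent X i l' (\<lambda>msg. \<exists>g' B' w. msg = Ready v (Hom g') B' w)" "sent X i l' (ready_stage v)"
      using lt l unfolding sent_def by auto
    show ?thesis
      using assms(1) l' s by (cases rule: ready_cases) (auto simp: ready_rule_def refine_rule_def)
  qed
  show ?thesis
    using later[OF _ assms(2,3)] later[OF _ assms(3,2)] assms(2,3)
    by (cases k k' rule: linorder_cases) auto
qed

section \<open>Agreement\<close>

lemma readies_subset: "readies X i m v B \<subseteq> parties X"
  by (auto simp: readies_def)

lemma readies_bcast:
  assumes "p \<in> readies X i m v B" "p \<in> correct X"
  shows "\<exists>k<m. \<exists>rg w. ev X k = Bcast p (Ready v rg B w)"
  using assms first_recv_bcast[of i m p] by (fastforce simp: readies_def)

lemma completion_unique: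
  assumes "completes X i m v B" "completes X j m' v B'"
  shows "B = B'"
proof -
  obtain p where "p \<in> readies X i m v B" "p \<in> readies X j m' v B'" "p \<in> correct X"
    using quorums_intersect[OF readies_subset _ readies_subset] assms
    unfolding completes_def by meson
  then show ?thesis
    using readies_bcast ready_unique by meson
qed

text \<open>An author counted through a refinement was already counted through its first mix READY
  for the same proposal, so grades never enlarge the tally.\<close>

lemma graded_readies_subset: "graded_readies X i m v B g \<subseteq> readies X i m v B"
proof
  fix j
  assume j: "j \<in> graded_readies X i m v B g"
  have "first_recv X i m j (ready_stage v) (Ready v Mix B w)"
    if "first_at X k i j (ready_stage v) (Ready v Mix B w)" "k < k'" "k' < m" for k k' w
    using that unfolding first_recv_def by (meson less_trans)
  then show "j \<in> readies X i m v B"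
    using j unfolding graded_readies_def readies_def by blast
qed

lemma graded_readies_bcast:
  assumes "p \<in> graded_readies X i m v B g" "p \<in> correct X"
  shows "\<exists>k w. ev X k = Bcast p (Ready v (Hom g) B w)"
proof -
  have "\<exists>k w. recv_at X k i p (Ready v (Hom g) B w)"
    using assms(1) first_recvD(2) unfolding graded_readies_def by blast
  then show ?thesis
    using recv_bcast[OF _ assms(2)] by blast
qed

lemma hom_quorum_completes: "hom_quorum X i m v B g \<Longrightarrow> completes X i m v B"
  unfolding hom_quorum_def completes_def
  using card_mono[OF finite_subset[OF readies_subset finite_parties] graded_readies_subset]
  by (meson order_trans)

text \<open>The proposals may differ in the hypotheses: a correct party in both tallies has only one
  homogeneous grade per view, whatever it names.\<close>

lemma hom_quorum_unique:
  assumes "hom_quorum X i m v B g" "hom_quorum X j m' v B' g'"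
  shows "g = g'"
proof -
  have sub: "graded_readies X i m v B g \<subseteq> parties X" for i m v B g
    using graded_readies_subset readies_subset by blast
  obtain p where "p \<in> graded_readies X i m v B g" "p \<in> graded_readies X j m' v B' g'" "p \<in> correct X"
    using quorums_intersect[OF sub _ sub] assms unfolding hom_quorum_def by meson
  then show ?thesis
    using graded_readies_bcast hom_ready_unique by meson
qed

lemma names_payload_outcome: "names_payload (outcome_of g B) B"
  by (cases g; cases B) auto

lemma direct_result_unique:
  "direct_result X i m v (CommitFull C T) \<Longrightarrow> \<not> direct_result X j m' v (CommitCore C')"
proof
  assume "direct_result X i m v (CommitFull C T)" "direct_result X j m' v (CommitCore C')"
  then obtain m0 m1 B B' g g' where h: "hom_quorum X i m0 v B g" "CommitFull C T = outcome_of g B"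
    "hom_quorum X j m1 v B' g'" "CommitCore C' = outcome_of g' B'"
    unfolding direct_result_def by blast
  then have "g = G1" "g' = G0"
    by (cases g; cases g'; cases B; cases B'; simp)+
  then show False
    using hom_quorum_unique[OF h(1,3)] by simp
qed

section \<open>Lanes\<close>

lemma hash_inj: "hash X b = hash X b' \<longleftrightarrow> b = b'"
  using exec by (auto simp: vantage_execution_def inj_eq)

lemma hash_chain_unique:
  assumes "hash_chain X a bs" "hash_chain X a' bs'" "length bs = length bs'"
    "bs \<noteq> []" "hash X (last bs) = hash X (last bs')"
  shows "bs = bs'"
proof -
  define n where "n = length bs"
  have len: "length bs = n" "length bs' = n"
    using assms(3) by (simp_all add: n_def)
  \<comment> \<open>\<open>d\<close> counts downwards from the last block. Equal hashes give equal
    blocks, and these contain the hashes of the blocks below them.\<close>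
  have eq: "bs ! (n - Suc d) = bs' ! (n - Suc d)" if "d < n" for d
    using that
  proof (induction d)
    case 0
    have "bs' \<noteq> []"
      using assms(3,4) by auto
    then show ?case
      using assms(4,5) len hash_inj by (simp add: last_conv_nth)
  next
    case (Suc d)
    define l where "l = n - Suc d"
    have l: "0 < l" "l < n" "n - Suc (Suc d) = l - 1"
      using Suc.prems by (auto simp: l_def)
    have "bs ! l = bs' ! l"
      using Suc by (simp add: l_def)
    moreover have "bprev (bs ! l) = hash X (bs ! (l - 1))" "bprev (bs' ! l) = hash X (bs' ! (l - 1))"
      using assms(1,2) l len unfolding hash_chain_def by auto
    ultimately show ?case
      using l(3) hash_inj by metis
  qed
  have "bs ! l = bs' ! l" if "l < n" for l
    using eq[of "n - Suc l"] that by (simp add: Suc_diff_Suc)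
  then show ?thesis
    using len by (simp add: list_eq_iff_nth_eq)
qed

lemma names_unique: "names X r bs \<Longrightarrow> names X r bs' \<Longrightarrow> bs = bs'"
  by (cases r) (auto simp: valid_lane_def intro: hash_chain_unique)

lemma names_length: "names X r bs \<Longrightarrow> length bs = fst (snd r) \<and> 0 < fst (snd r)"
  by (cases r) auto

lemma names_block:
  assumes "names X r bs" "b \<in> set bs"
  shows "bauthor b = fst r \<and> data_block X b \<and> block_ok X b"
proof -
  obtain l where "l < length bs" "b = bs ! l"
    using assms(2) by (metis in_set_conv_nth)
  then show ?thesis
    using assms by (cases r) (auto simp: valid_lane_def hash_chain_def)
qed

lemma names_anc:
  assumes "names X r bs" "1 \<le> l" "l \<le> length bs"
  shows "names X (anc X r bs l) (take l bs)"
proof -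
  have "hash_chain X a (take l bs)" if "hash_chain X a bs" for a
    using that by (auto simp: hash_chain_def)
  then show ?thesis
    using assms by (cases r)
      (auto simp: anc_def valid_lane_def last_conv_nth min_def dest: in_set_takeD)
qed

lemma storage: "i \<in> correct X \<Longrightarrow> storage_ok X i"
  using exec by (simp add: vantage_execution_def)

text \<open>The storage rule admits such a block at its reception and, the block being first-hand
  from then on, keeps it at every later event.\<close>

lemma store_first_hand:
  assumes "i \<in> correct X" "data_block X b" "block_ok X b" "first_hand X i m b"
  shows "b \<in> store X i m"
proof -
  obtain k where k: "k < m" "recv_at X k i (bauthor b) (Publish b)"
    using assms(4) by (auto simp: first_hand_def)
  from k(1) have "Suc k \<le> m"
    by simp
  then show ?thesis
  proof (induction m rule: dec_induct)
    case base
    then show ?case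
      using storage[OF assms(1)] assms(2,3) k(2) unfolding storage_ok_def by blast
  next
    case (step m)
    have "first_hand X i m b"
      using k(2) step.hyps unfolding first_hand_def by (meson Suc_le_lessD)
    then show ?case
      using storage[OF assms(1)] assms(2,3) step.IH unfolding storage_ok_def by blast
  qed
qed

lemma first_hand_mono: "first_hand X i m b \<Longrightarrow> m \<le> m' \<Longrightarrow> first_hand X i m' b"
  unfolding first_hand_def using less_le_trans by blast

lemma direct_pubI:
  assumes "i \<in> correct X" "names X r bs" "\<And>b. b \<in> set bs \<Longrightarrow> first_hand X i m b"
  shows "direct_pub X i m r" "set bs \<subseteq> store X i m"
proof -
  show "set bs \<subseteq> store X i m"
    using store_first_hand[OF assms(1)] names_block[OF assms(2)] assms(3) by blast
  then show "direct_pub X i m r"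
    using assms(2,3) unfolding direct_pub_def by blast
qed

text \<open>The store as a whole may shrink, but the blocks of a valid lane that were received
  first-hand are never dropped.\<close>

lemma direct_pub_mono:
  assumes "i \<in> correct X" "direct_pub X i m r" "m \<le> m'"
  shows "direct_pub X i m' r"
proof -
  obtain bs where "names X r bs" "\<And>b. b \<in> set bs \<Longrightarrow> first_hand X i m b"
    using assms(2) by (auto simp: direct_pub_def)
  then show ?thesis
    using direct_pubI(1)[OF assms(1)] first_hand_mono assms(3) by blast
qed

lemma direct_pub_anc:
  assumes "direct_pub X i m r" "names X r bs" "1 \<le> l" "l \<le> length bs"
  shows "direct_pub X i m (anc X r bs l)"
proof -
  have "set bs \<subseteq> store X i m" "\<forall>b\<in>set bs. first_hand X i m b"
    using assms(1) names_unique[OF assms(2)] by (auto simp: direct_pub_def)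
  then show ?thesis
    using names_anc[OF assms(2-4)] unfolding direct_pub_def
    by (meson in_set_takeD set_take_subset subset_trans)
qed

section \<open>Soundness of claims and acknowledgments\<close>

lemma anc_anc: "l \<le> l' \<Longrightarrow> 1 \<le> l \<Longrightarrow> anc X (anc X r bs l') (take l' bs) l = anc X r bs l"
  by (auto simp: anc_def)

text \<open>Soundness of honest claims. Each claim points to a reference that is directly published,
  either \<open>r\<close> itself or the ancestor at the claimed depth, and direct publication passes
  down to ancestors.\<close>

lemma claim_direct_pub:
  assumes "names X r bs" "1 \<le> l" "l \<le> claim_height (length bs) (claim_for X i m r)"
  shows "direct_pub X i m (anc X r bs l)"
proof (cases "direct_pub X i m r")
  case True
  then show ?thesis
    using assms direct_pub_anc by (simp add: claim_for_def)
next
  case False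
  then have ex: "\<exists>d. pub_depth X i m r d"
    using assms(2,3) by (auto simp: claim_for_def split: if_splits)
  define d where "d = (LEAST d. pub_depth X i m r d)"
  have "pub_depth X i m r d"
    using ex unfolding d_def by (rule LeastI_ex)
  then have d: "0 < d" "d < length bs" "direct_pub X i m (anc X r bs (length bs - d))"
    using names_unique[OF assms(1)] by (auto simp: pub_depth_def)
  have l: "l \<le> length bs - d"
    using assms(3) False ex d(1,2) by (simp add: claim_for_def flip: d_def)
  \<comment> \<open>The anchor of an integer claim is itself a reference, and its ancestors are
    ancestors of \<open>r\<close>.\<close>
  have "direct_pub X i m (anc X (anc X r bs (length bs - d)) (take (length bs - d) bs) l)"
    using direct_pub_anc[OF d(3) names_anc[OF assms(1)] assms(2)] d(2) l by simp
  then show ?thesis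
    using anc_anc[OF l assms(2)] by simp
qed

text \<open>The grade can be ignored here: the fallback ECHO, too, demands an active proposal and a
  passed core check.\<close>

lemma echo_counted_bcast:
  assumes "echo_counted X i m j v g B cl" "j \<in> correct X"
  shows "\<exists>k<m. (\<exists>w. ev X k = Bcast j (Echo v g B cl w)) \<and> cl = claims_of X j k B \<and>
           active X j k v B \<and> core_ok X j k (fst B)"
proof -
  obtain w k where k: "k < m" "ev X k = Bcast j (Echo v g B cl w)"
    using assms first_recv_bcast unfolding echo_counted_def by blast
  then show ?thesis
    using bcast[OF k(2) assms(2)] by (auto simp: echo_full_rule_def split: grade.splits)
qed

text \<open>A correct sender computes its claims from its own state at the moment of the ECHO. Every
  way of counting them thus leads back to a direct publication there, which persists.\<close>

lemma ack_direct_pub: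
  assumes "ack X i m j r" "j \<in> correct X"
  shows "direct_pub X j m r"
proof -
  have "\<exists>k<m. direct_pub X j k r"
  proof (cases "exact_ack X i m j r")
    case True
    then obtain v g B cl where e: "echo_counted X i m j v g B cl" "cl r = Some Exact"
      by (auto simp: exact_ack_def)
    obtain k where "k < m" "cl = claims_of X j k B"
      using echo_counted_bcast[OF e(1) assms(2)] by blast
    then show ?thesis
      using e(2) by (auto simp: claims_of_def claim_for_def split: if_splits)
  next
    case False
    then obtain m' v g B cl r0 bs l where e: "m' \<le> m" "echo_counted X i m' j v g B cl" "r0 \<in> refs B"
      "names X r0 bs" "1 \<le> l" "l \<le> claim_height (length bs) (cl r0)" "r = anc X r0 bs l"
      using assms(1) unfolding ack_def by blast
    obtain k where "k < m'" "cl = claims_of X j k B"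
      using echo_counted_bcast[OF e(2) assms(2)] by blast
    then show ?thesis
      using claim_direct_pub[OF e(4,5), of j k] e by (auto simp: claims_of_def intro: less_le_trans)
  qed
  then show ?thesis
    using direct_pub_mono[OF assms(2)] less_imp_le by blast
qed

text \<open>Among \<open>f + 1\<close> acknowledging parties one is correct, and its acknowledgment
  is sound.\<close>

lemma author_ok_backed:
  assumes "i \<in> correct X" "author_ok X i m r"
  shows "\<exists>j\<in>correct X. direct_pub X j m r"
proof (cases "direct_pub X i m r")
  case False
  then have "flt X < card {j \<in> parties X. ack X i m j r}"
    using assms(2) by (simp add: author_ok_def avail_def)
  then obtain j where "ack X i m j r" "j \<in> correct X"
    using correct_in_large[of "{j \<in> parties X. ack X i m j r}"] by auto
  then show ?thesis
    using ack_direct_pub by blast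
qed (use assms(1) in blast)

lemma echoes_subset: "echoes X i m v B \<subseteq> parties X"
  by (auto simp: echoes_def)

text \<open>The chain runs backwards in time: a correct READY sender \<open>p\<close> among the
  quorum, a correct echoer \<open>q\<close> among the ECHOs counted by \<open>p\<close>, and the
  core check passed by \<open>q\<close>, which yields the first-hand holder
  \<open>j\<close>.\<close>

lemma completion_core_backed:
  assumes "completes X i m v B" "r \<in> mrefs (fst B)"
  shows "\<exists>j\<in>correct X. direct_pub X j m r"
proof -
  have "quorum X \<le> card (readies X i m v B)"
    using assms(1) by (simp add: completes_def)
  then obtain p where p: "p \<in> readies X i m v B" "p \<in> correct X"
    using correct_in_quorum[OF readies_subset] by blast
  obtain k rg w where "k < m" and e: "ev X k = Bcast p (Ready v rg B w)"
    using readies_bcast[OF p] by blast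
  moreover obtain l where "l \<le> k" "ready_rule X p l v B"
    using ready_origin[OF p(2) e] by blast
  ultimately have k: "k < m" "l \<le> k" "quorum X \<le> card (echoes X p l v B)"
    by (simp_all add: ready_rule_def)
  obtain q where q: "q \<in> echoes X p l v B" "q \<in> correct X"
    using correct_in_quorum[OF echoes_subset k(3)] by blast
  obtain l' where l': "l' < l" "core_ok X q l' (fst B)"
    using q(1) echo_counted_bcast[OF _ q(2)] unfolding echoes_def by blast
  then have "author_ok X q l' r"
    using assms(2) by (simp add: core_ok_def)
  then obtain j where j: "j \<in> correct X" "direct_pub X j l' r"
    using author_ok_backed[OF q(2)] by blast
  have "l' \<le> m"
    using k(1,2) l'(1) by linarith
  then show ?thesis
    using direct_pub_mono[OF j] j(1) by blast
qed

lemma direct_pub_permanent: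
  assumes "j \<in> correct X" "direct_pub X j m r"
  shows "\<exists>bs. names X r bs \<and> (\<forall>m'\<ge>m. set bs \<subseteq> store X j m') \<and>
           (\<forall>b\<in>set bs. \<exists>k<m. recv_at X k j (fst r) (Publish b))"
proof -
  obtain bs where bs: "names X r bs" "\<forall>b\<in>set bs. first_hand X j m b"
    using assms(2) by (auto simp: direct_pub_def)
  have "set bs \<subseteq> store X j m'" if "m \<le> m'" for m'
    using direct_pubI(2)[OF assms(1) bs(1)] bs(2) first_hand_mono that by blast
  moreover have "\<exists>k<m. recv_at X k j (fst r) (Publish b)" if "b \<in> set bs" for b
    using bs(2) that names_block[OF bs(1) that] unfolding first_hand_def by metis
  ultimately show ?thesis
    using bs(1) by blast
qed

lemma completion_core:
  assumes "completes X i m v (C, T)"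
  shows "valid_manifest X C" "author_backed X m C" "retrievable X m C"
proof -
  have b: "\<exists>j\<in>correct X. \<exists>bs. names X r bs \<and> (\<forall>m'\<ge>m. set bs \<subseteq> store X j m') \<and>
      (\<forall>b\<in>set bs. \<exists>k<m. recv_at X k j (fst r) (Publish b))" if "r \<in> mrefs C" for r
    using completion_core_backed[OF assms] that direct_pub_permanent by fastforce
  show "author_backed X m C"
    using b by (simp add: author_backed_def)
  show "retrievable X m C"
    unfolding retrievable_def using b by meson
  show "valid_manifest X C"
    unfolding valid_manifest_def using b by (fastforce simp: valid_lane_def)
qed

section \<open>Monotonicity of checks\<close>

lemma echo_counted_mono:
  "echo_counted X i m j v g B cl \<Longrightarrow> m \<le> m' \<Longrightarrow> echo_counted X i m' j v g B cl"
  unfolding echo_counted_def using first_recv_mono by blast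

lemma ack_mono:
  assumes "ack X i m j r" "m \<le> m'"
  shows "ack X i m' j r"
proof (cases "exact_ack X i m j r")
  case True
  then have "exact_ack X i m' j r"
    using echo_counted_mono[OF _ assms(2)] unfolding exact_ack_def by blast
  then show ?thesis
    by (simp add: ack_def)
next
  case False
  then show ?thesis
    using assms order_trans[OF _ assms(2)] unfolding ack_def by blast
qed

lemma author_ok_mono:
  assumes "i \<in> correct X" "author_ok X i m r" "m \<le> m'"
  shows "author_ok X i m' r"
proof -
  have "card {j \<in> parties X. ack X i m j r} \<le> card {j \<in> parties X. ack X i m' j r}"
    by (intro card_mono) (auto simp: finite_parties intro: ack_mono[OF _ assms(3)])
  then show ?thesis
    using assms(2) direct_pub_mono[OF assms(1) _ assms(3)] unfolding author_ok_def avail_def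
    by (meson order_trans)
qed

lemma own_publish: "i \<in> correct X \<Longrightarrow> ev X k = Bcast i (Publish b) \<Longrightarrow> bauthor b = i"
proof -
  assume "i \<in> correct X" "ev X k = Bcast i (Publish b)"
  then obtain bs where "valid_lane X i (bs @ [b])"
    using bcast by fastforce
  then have "bauthor ((bs @ [b]) ! length bs) = i"
    unfolding valid_lane_def hash_chain_def by (metis length_append_singleton lessI)
  then show ?thesis
    by simp
qed

text \<open>Without deliveries, a party can still receive its own blocks and its own ECHOs. The former
  concern only its own lane, and the latter acknowledge only what is directly published there.\<close>

lemma author_ok_without_delivery:
  assumes i: "i \<in> correct X" and "m \<le> m'"
    and quiet: "\<And>k j msg. m \<le> k \<Longrightarrow> k < m' \<Longrightarrow> ev X k \<noteq> Deliver j i msg"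
    and ok: "author_ok X i m' r" and other: "fst r \<noteq> i"
  shows "author_ok X i m r"
proof -
  have recv: "\<not> recv_at X k i j msg" if "m \<le> k" "k < m'" "j \<noteq> i" for k j msg
    using quiet[OF that(1,2)] that(3) by (auto simp: recv_at_def)
  have first: "first_recv X i m j P msg" if "first_recv X i m'' j P msg" "m'' \<le> m'" "j \<noteq> i"
    for m'' j P msg
    using that recv unfolding first_recv_def first_at_def by (meson less_le_trans not_le)
  \<comment> \<open>Without deliveries only own broadcasts could add blocks. A correct party never
    broadcasts a \<open>Repair\<close>, and whatever it publishes names itself as author.\<close>
  have store: "b \<in> store X i m" if "b \<in> store X i m''" "m'' \<le> m'" "bauthor b \<noteq> i" "m \<le> m''" for m'' b
    using that(4,1,2)
  proof (induction m'' rule: dec_induct)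
    case (step l)
    have own: "j = i \<and> ev X l = Bcast i msg" if "recv_at X l i j msg" for j msg
      using that quiet[of l] step.hyps step.prems(2) by (auto simp: recv_at_def)
    have "\<not> recv_at X l i j (Publish b)" for j
      using own[of j "Publish b"] own_publish[OF i] \<open>bauthor b \<noteq> i\<close> by blast
    moreover have "\<not> recv_at X l i j (Repair b)" for j
      using own[of j "Repair b"] bcast[of l i "Repair b"] i by auto
    ultimately have "b \<in> store X i l"
      using storage[OF i] step.prems(1) unfolding storage_ok_def by blast
    then show ?case
      using step.IH step.prems(2) by simp
  qed
  have dp: "author_ok X i m r" if d: "direct_pub X i m' r"
  proof -
    obtain bs where bs: "names X r bs" "\<forall>b\<in>set bs. first_hand X i m' b"
      using d by (auto simp: direct_pub_def)
    have "first_hand X i m b" if "b \<in> set bs" for b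
      using bs(2) that names_block[OF bs(1) that] other recv unfolding first_hand_def
      by (metis not_le)
    then show ?thesis
      using direct_pubI(1)[OF i bs(1)] by (simp add: author_ok_def)
  qed
  have ack: "ack X i m j r" if a: "ack X i m' j r" and "j \<noteq> i" for j
  proof (cases "exact_ack X i m' j r")
    case True
    then have "exact_ack X i m j r"
      using first[OF _ order_refl \<open>j \<noteq> i\<close>] unfolding exact_ack_def echo_counted_def by meson
    then show ?thesis
      by (simp add: ack_def)
  next
    case False
    then obtain m'' v g B cl r0 bs l where e: "m'' \<le> m'" "echo_counted X i m'' j v g B cl"
      "r0 \<in> refs B" "names X r0 bs" "set bs \<subseteq> store X i m''" "1 \<le> l"
      "l \<le> claim_height (length bs) (cl r0)" "r = anc X r0 bs l"
      using a unfolding ack_def by blast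
    show ?thesis
    proof (cases "m'' \<le> m")
      case True
      then show ?thesis
        using e unfolding ack_def by blast
    next
      case False
      have "bauthor b \<noteq> i" if "b \<in> set bs" for b
        using names_block[OF e(4) that] other e(8) by (simp add: anc_def)
      then have "set bs \<subseteq> store X i m"
        using store[OF _ e(1)] e(5) False by auto
      moreover have "echo_counted X i m j v g B cl"
        using e(2) first[OF _ e(1) \<open>j \<noteq> i\<close>] unfolding echo_counted_def by blast
      ultimately show ?thesis
        using e(3,4,6-8) unfolding ack_def by blast
    qed
  qed
  show ?thesis
  proof (cases "direct_pub X i m' r")
    case True
    then show ?thesis
      by (rule dp)
  next
    case False
    \<comment> \<open>The remaining new acknowledgment could only be that of \<open>i\<close>
      itself, and this would already mean direct publication at \<open>i\<close>.\<close>
    then have "\<not> ack X i m' i r"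
      using ack_direct_pub i by blast
    then have "{j \<in> parties X. ack X i m' j r} \<subseteq> {j \<in> parties X. ack X i m j r}"
      using ack by auto
    then have "card {j \<in> parties X. ack X i m' j r} \<le> card {j \<in> parties X. ack X i m j r}"
      by (intro card_mono) (auto simp: finite_parties)
    then show ?thesis
      using ok False by (simp add: author_ok_def avail_def)
  qed
qed

section \<open>Proposals of correct parties\<close>

lemma core_policy_entry:
  assumes "core_policy X i m C" "C a = Some e"
  shows "a \<in> parties X \<and> direct_pub X i m (a, e)"
proof -
  have "a \<in> parties X"
    using assms unfolding core_policy_def by blast
  moreover have "newest (core_cands X i m a) e"
    using assms calculation unfolding core_policy_def by fastforce
  ultimately show ?thesis
    by (cases e) (simp add: core_cands_def)
qed

lemma tip_policy_entry:
  assumes "tip_policy X i m C T" "T a = Some e"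
  shows "a \<in> parties X \<and> direct_pub X i m (a, e) \<and>
    (\<exists>bs. names X (a, e) bs \<and> (\<forall>e'. C a = Some e' \<longrightarrow> strictly_contains X bs e'))"
proof -
  have a: "a \<in> parties X"
    using assms unfolding tip_policy_def by blast
  have "tip_entry X i m C T a"
    using assms a unfolding tip_policy_def by (metis option.distinct(1))
  then have "e \<in> tip_cands X i m C T a"
    using assms(2) by (cases e) (auto simp: tip_entry_def partial_tip_cands_def split: if_splits)
  then show ?thesis
    using a by (cases e) (auto simp: tip_cands_def)
qed

text \<open>The hash determines the last block, and the block records its author and its
  height.\<close>

lemma ref_hash_inj:
  assumes "direct_pub X i m (a, k, h)" "direct_pub X i' m' (a', k', h)"
  shows "a = a' \<and> k = k'"
proof -
  obtain bs bs' where b: "names X (a, k, h) bs" "names X (a', k', h) bs'"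
    using assms by (auto simp: direct_pub_def)
  then have "last bs = last bs'"
    using hash_inj[of "last bs" "last bs'"] by simp
  moreover have "bauthor (last bs) = a \<and> bheight (last bs) = k"
    using b(1) by (auto simp: valid_lane_def hash_chain_def last_conv_nth)
  moreover have "bauthor (last bs') = a' \<and> bheight (last bs') = k'"
    using b(2) by (auto simp: valid_lane_def hash_chain_def last_conv_nth)
  ultimately show ?thesis
    by simp
qed

lemma proposal_policy:
  assumes "p \<in> correct X" "ev X k = Bcast p (Proposal v B)"
  shows "core_policy X p k (fst B)" "tip_policy X p k (fst B) (snd B)" "started X p k" "1 \<le> v"
  using bcast[OF assms(2,1)] by (auto simp: propose_rule_def)

lemma proposal_refs:
  assumes "p \<in> correct X" "ev X k = Bcast p (Proposal v B)" "r \<in> refs B"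
  shows "fst r \<in> parties X \<and> direct_pub X p k r"
  using assms(3) core_policy_entry[OF proposal_policy(1)[OF assms(1,2)]]
    tip_policy_entry[OF proposal_policy(2)[OF assms(1,2)]]
  by (fastforce simp: refs_def mrefs_def)

lemma proposal_well_formed:
  assumes "p \<in> correct X" "ev X k = Bcast p (Proposal v B)"
  shows "well_formed X B"
proof -
  note pol = core_policy_entry[OF proposal_policy(1)[OF assms]]
    tip_policy_entry[OF proposal_policy(2)[OF assms]]
  obtain C T where B: "B = (C, T)"
    by (cases B)
  have dom: "dom C \<subseteq> parties X" "dom T \<subseteq> parties X"
    using pol B by auto
  have "0 < k" if "(a, k, h) \<in> refs B" for a k h
    using proposal_refs[OF assms that] names_length by (fastforce simp: direct_pub_def)
  moreover have "inj_on (\<lambda>(tip, a). snd (the ((if tip then T else C) a)))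
       ({False} \<times> dom C \<union> {True} \<times> dom T)"
  proof (rule inj_onI, clarify)
    fix t a t' a'
    assume "(t, a) \<in> {False} \<times> dom C \<union> {True} \<times> dom T"
      "(t', a') \<in> {False} \<times> dom C \<union> {True} \<times> dom T"
      and h: "snd (the ((if t then T else C) a)) = snd (the ((if t' then T else C) a'))"
    then obtain l l' y where e: "(if t then T else C) a = Some (l, y)"
      "(if t' then T else C) a' = Some (l', y)"
      by auto
    have "direct_pub X p k (a, l, y)" "direct_pub X p k (a', l', y)"
      using e pol B by (auto split: if_splits)
    then have eq: "a = a'" "l = l'"
      using ref_hash_inj by blast+
    \<comment> \<open>A tip strictly contains the core entry of its author, so an entry listed in
      both manifests would have height below itself.\<close>
    have "False" if "C a = Some (l, y)" "T a = Some (l, y)"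
      using pol(2)[of a "(l, y)"] that B names_length by fastforce
    then show "t = t' \<and> a = a'"
      using e eq by (auto split: if_splits)
  qed
  ultimately show ?thesis
    using dom unfolding well_formed_def B fst_conv snd_conv by blast
qed

section \<open>Time\<close>

lemma tm_mono: "k \<le> l \<Longrightarrow> tm X k \<le> tm X l"
  using exec by (simp add: vantage_execution_def monoD)

lemma tm_nonneg: "0 \<le> tm X k"
  using exec by (simp add: vantage_execution_def)

lemma now_mono: "m \<le> m' \<Longrightarrow> now X m \<le> now X m'"
  by (auto simp: now_def tm_nonneg intro!: tm_mono)

lemma tm_le_now: "k < m \<Longrightarrow> tm X k \<le> now X m"
  by (auto simp: now_def intro!: tm_mono)

text \<open>Time diverges along the trace, so there is a first event after \<open>t\<close>; the
  state before it has seen all events up to \<open>t\<close>. The assumption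
  \<open>0 \<le> t\<close> covers the initial state, whose time is 0.\<close>

lemma state_at:
  assumes "0 \<le> t"
  obtains m where "now X m \<le> t" "\<And>k. tm X k \<le> t \<Longrightarrow> k < m"
proof -
  define m where "m = (LEAST k. t < tm X k)"
  have "\<exists>k. t < tm X k"
    using exec by (simp add: vantage_execution_def)
  then have m: "t < tm X m"
    unfolding m_def by (rule LeastI_ex)
  have "\<not> t < tm X (m - 1)" if "m \<noteq> 0"
    using not_less_Least[of "m - 1" "\<lambda>k. t < tm X k"] that by (simp flip: m_def)
  then have "now X m \<le> t"
    using assms by (auto simp: now_def)
  moreover have "k < m" if "tm X k \<le> t" for k
    using m tm_mono[of m k] that by (meson not_le order_trans)
  ultimately show ?thesis
    using that by blast
qed

lemma started_mono: "started X i m \<Longrightarrow> m \<le> m' \<Longrightarrow> started X i m'"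
  unfolding started_def by (rule sent_mono)

lemma entered_mono: "entered X i m v \<Longrightarrow> m \<le> m' \<Longrightarrow> entered X i m' v"
  unfolding entered_def using started_mono order_trans by meson

lemma entry_time_le: "entered X i m v \<Longrightarrow> entry_time X i v \<le> now X m"
  unfolding entry_time_def by (intro now_mono Least_le)

lemma receipt_time_le: "fixed X i m v B \<Longrightarrow> receipt_time X i v \<le> now X m"
  unfolding receipt_time_def by (intro now_mono Least_le) blast

text \<open>The message received first may be another one than that at event \<open>k\<close>, but a
  correct proposer sends only one proposal per view.\<close>

lemma fixedI:
  assumes "proposer X v \<in> correct X" "ev X k0 = Bcast (proposer X v) (Proposal v B)"
    "recv_at X k i (proposer X v) (Proposal v B)" "k < m"
  shows "fixed X i m v B"
proof -
  obtain msg where msg: "first_recv X i m (proposer X v) (is_proposal v) msg"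
    using first_recv_exists[OF assms(3) _ assms(4), of "is_proposal v"] by auto
  then obtain B' where B': "msg = Proposal v B'"
    using first_recvD(1) by (cases msg) fastforce+
  then obtain l where "ev X l = Bcast (proposer X v) (Proposal v B')"
    using first_recv_bcast[OF msg assms(1)] by auto
  then have "B' = B"
    using proposal_unique[OF assms(1,2)] by simp
  then show ?thesis
    using msg B' by (simp add: fixed_def)
qed

lemma fixed_unique:
  assumes "proposer X v \<in> correct X" "ev X k0 = Bcast (proposer X v) (Proposal v B)"
    "fixed X i m v B'"
  shows "B' = B" and "\<exists>k<m. k0 \<le> k"
proof -
  obtain k where k: "k < m" "ev X k = Bcast (proposer X v) (Proposal v B')"
    using first_recv_bcast[of i m] assms(1,3) unfolding fixed_def by blast
  then show "B' = B" "\<exists>k<m. k0 \<le> k"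
    using proposal_unique[OF assms(1,2) k(2)] by auto
qed

lemma receipt_time_ge:
  assumes "proposer X v \<in> correct X" "ev X k0 = Bcast (proposer X v) (Proposal v B)"
    "fixed X i m v B'"
  shows "tm X k0 \<le> receipt_time X i v"
proof -
  define l where "l = (LEAST m. \<exists>B. fixed X i m v B)"
  have "\<exists>B. fixed X i l v B"
    unfolding l_def by (rule LeastI) (use assms(3) in blast)
  then obtain k where "k < l" "k0 \<le> k"
    using fixed_unique(2)[OF assms(1,2)] by blast
  then show ?thesis
    using tm_mono tm_le_now unfolding receipt_time_def l_def by (meson order_trans)
qed

text \<open>Common interface for delivery: it can be reached either by letting \<delta> pass after
  \<open>t\<close> (\<open>heard_after\<close>) or from the fact that a timeout fires
  (\<open>timeout_heard\<close>).\<close>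

definition heard :: "nat \<Rightarrow> nat \<Rightarrow> real \<Rightarrow> bool" where
  "heard i m t \<longleftrightarrow> (\<forall>j\<in>correct X. \<forall>k msg. ev X k = Bcast j msg \<and> tm X k \<le> t \<longrightarrow>
     (\<exists>k'<m. recv_at X k' i j msg))"

lemma heardD:
  "heard i m t \<Longrightarrow> j \<in> correct X \<Longrightarrow> ev X k = Bcast j msg \<Longrightarrow> tm X k \<le> t \<Longrightarrow>
    \<exists>k'<m. recv_at X k' i j msg"
  by (auto simp: heard_def)

lemma heard_mono: "heard i m t \<Longrightarrow> m \<le> m' \<Longrightarrow> heard i m' t"
  unfolding heard_def using less_le_trans by blast

lemma heard_fixed:
  assumes "heard i m (tm X k)" "proposer X v \<in> correct X"
    "ev X k = Bcast (proposer X v) (Proposal v B)"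
  shows "fixed X i m v B"
  using heardD[OF assms(1-3)] fixedI[OF assms(2,3)] by blast

text \<open>The party \<open>p\<close> received the blocks from their correct author before event
  \<open>k\<close>, so they were broadcast by then, and \<open>i\<close> has received the same
  broadcasts.\<close>

lemma heard_direct_pub:
  assumes "heard i m (tm X k)" "direct_pub X p k r" "i \<in> correct X" "fst r \<in> correct X"
  shows "direct_pub X i m r"
proof -
  obtain bs where bs: "names X r bs" "\<forall>b\<in>set bs. first_hand X p k b"
    using assms(2) by (auto simp: direct_pub_def)
  have "first_hand X i m b" if b: "b \<in> set bs" for b
  proof -
    have c: "bauthor b \<in> correct X"
      using names_block[OF bs(1) b] assms(4) by simp
    obtain l where l: "l < k" "recv_at X l p (bauthor b) (Publish b)"
      using bs(2) b by (auto simp: first_hand_def)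
    then obtain l' where "l' \<le> l" "ev X l' = Bcast (bauthor b) (Publish b)"
      using recv_bcast[OF l(2) c] by blast
    then show ?thesis
      using heardD[OF assms(1) c] tm_mono[of l' k] l(1) unfolding first_hand_def
      by (meson le_trans less_imp_le)
  qed
  then show ?thesis
    using direct_pubI(1)[OF assms(3) bs(1)] by blast
qed

text \<open>Only the first echo-stage statement of an author counts; a correct author sends just
  one, so the received ECHO is that one.\<close>

lemma heard_echo:
  assumes "heard i m t" "j \<in> correct X" "ev X k = Bcast j (Echo v g B cl w)" "tm X k \<le> t"
  shows "echo_counted X i m j v g B cl"
proof -
  obtain k' where "k' < m" "recv_at X k' i j (Echo v g B cl w)"
    using heardD[OF assms] by blast
  then obtain msg where msg: "first_recv X i m j (echo_stage v) msg"
    using first_recv_exists[of k' i j _ "echo_stage v"] by fastforce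
  have st: "echo_stage v msg"
    by (rule first_recvD(1)[OF msg])
  then obtain l where "ev X l = Bcast j msg"
    using first_recv_bcast[OF msg assms(2)] by fastforce
  then have "msg = Echo v g B cl w"
    using echo_stage_unique[OF assms(2) _ assms(3) st] by simp
  then show ?thesis
    using msg by (auto simp: echo_counted_def)
qed

end

section \<open>A synchronous view with a correct proposer\<close>

text \<open>These assumptions are what a pacemaker cutoff provides for one later view with a correct
  proposer; \<open>s\<close> is the first correct entry and \<open>k0\<close> the event that sends
  the proposal.\<close>

locale synchronous_view = vantage X
  for X :: "('s, 'h::linorder, 'x) execution" +
  fixes v :: nat and B :: "'h proposal" and k0 :: nat and s :: real
  assumes sync: "partially_synchronous X"
    and proposer: "proposer X v \<in> correct X"
    and proposal: "ev X k0 = Bcast (proposer X v) (Proposal v B)"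
    and wf: "well_formed X B"
    and gst_proposal: "gst X \<le> tm X k0"
    and first_entry: "first_entry X v s"
    and gst_entry: "gst X \<le> s"
    and proposal_le: "tm X k0 \<le> s + delta X"
    and entry_le: "\<And>i. i \<in> correct X \<Longrightarrow> by_time X (s + 2 * delta X) (\<lambda>m. entered X i m v)"
begin

lemma delta: "0 < delta X" "delta X \<le> Delta X" and gst_nonneg: "0 \<le> gst X"
  using sync by (auto simp: partially_synchronous_def)

lemma view_pos: "1 \<le> v"
  using proposal_policy(4)[OF proposer proposal] .

lemma delivery:
  assumes "i \<in> correct X" "j \<in> correct X" "ev X k = Bcast j msg" "tm X k \<le> t" "gst X \<le> t"
  shows "\<exists>k'. recv_at X k' i j msg \<and> tm X k' \<le> t + delta X"
proof -
  obtain k' where "recv_at X k' i j msg" "tm X k' \<le> max (tm X k) (gst X) + delta X"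
    using sync assms(1-3) unfolding partially_synchronous_def by meson
  then show ?thesis
    using assms(4,5) by (smt (verit))
qed

lemma heard_after:
  assumes "i \<in> correct X" "gst X \<le> t" "\<And>k. tm X k \<le> t + delta X \<Longrightarrow> k < m"
  shows "heard i m t"
  unfolding heard_def using delivery[OF assms(1) _ _ _ assms(2)] assms(3) by meson

lemma clk_mono: "i \<in> correct X \<Longrightarrow> t \<le> t' \<Longrightarrow> clk X i t \<le> clk X i t'"
  using exec by (auto simp: vantage_execution_def monoD)

text \<open>Deadlines are clock values plus durations; after GST this turns them into clock values
  of real times, which monotonicity can compare.\<close>

lemma clk_add:
  assumes "i \<in> correct X" "gst X \<le> t" "0 \<le> \<theta>"
  shows "clk X i (t + \<theta>) = clk X i t + \<theta>"
proof -
  have "clk X i (t + \<theta>) - clk X i t = (t + \<theta>) - t"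
    using sync assms unfolding partially_synchronous_def by (metis le_add_same_cancel1)
  then show ?thesis
    by simp
qed

text \<open>Broadcasts made by \<open>t\<close> arrive by \<open>t + \<delta>\<close>, when the
  local clock shows at most \<open>D\<close>, and a timeout waits for everything delivered by
  \<open>D\<close>. This holds however late or early the timeout event itself is.\<close>

lemma timeout_heard:
  assumes i: "i \<in> correct X" and t: "gst X \<le> t" and bc: "ev X m = Bcast i msg0"
    and to: "timeout X i m D" and D: "clk X i (t + delta X) \<le> D"
  shows "heard i m t"
  unfolding heard_def
proof (intro ballI allI impI, elim conjE)
  fix j k msg
  assume j: "j \<in> correct X" and k: "ev X k = Bcast j msg" "tm X k \<le> t"
  show "\<exists>k'<m. recv_at X k' i j msg"
  proof (cases "j = i")
    case True
    \<comment> \<open>Own broadcasts need no delivery but must precede event \<open>m\<close>; the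
      strict inequality comes from \<delta> > 0.\<close>
    have "clk X i t < clk X i (tm X m)"
      using clk_add[OF i t, of "delta X"] delta(1) D to by (simp add: timeout_def)
    then have "t < tm X m"
      using clk_mono[OF i, of "tm X m" t] by linarith
    then have "k < m"
      using k(2) tm_mono[of m k] by (meson not_le order_trans)
    then show ?thesis
      using True k(1) by (auto simp: recv_at_def)
  next
    case False
    obtain k' where k': "recv_at X k' i j msg" "tm X k' \<le> t + delta X"
      using delivery[OF i j k t] by blast
    have del: "ev X k' = Deliver j i msg"
      using k'(1) False by (auto simp: recv_at_def)
    have "\<not> D < clk X i (tm X k')"
      using clk_mono[OF i k'(2)] D by linarith
    then have "\<not> m < k'"
      using to del unfolding timeout_def by blast
    moreover have "k' \<noteq> m"
      using del bc by auto
    ultimately show ?thesis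
      using k'(1) by (meson linorder_neqE_nat)
  qed
qed

lemma entry:
  assumes "i \<in> correct X"
  shows "s \<le> entry_time X i v" "entry_time X i v \<le> s + 2 * delta X"
proof -
  obtain m where m: "now X m \<le> s + 2 * delta X" "entered X i m v"
    using entry_le[OF assms] by (auto simp: by_time_def)
  then show "entry_time X i v \<le> s + 2 * delta X"
    using entry_time_le[OF m(2)] by simp
  have "entered X i (LEAST m. entered X i m v) v"
    using m(2) by (rule LeastI)
  then show "s \<le> entry_time X i v"
    using first_entry assms unfolding first_entry_def entry_time_def by blast
qed

lemma receipt:
  assumes "i \<in> correct X"
  shows "tm X k0 \<le> receipt_time X i v" "receipt_time X i v \<le> tm X k0 + delta X"
proof -
  obtain m where m: "now X m \<le> tm X k0 + delta X" "\<And>k. tm X k \<le> tm X k0 + delta X \<Longrightarrow> k < m"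
    using state_at[of "tm X k0 + delta X"] tm_nonneg[of k0] delta(1)
    by (metis add_nonneg_nonneg less_imp_le)
  have f: "fixed X i m v B"
    using heard_fixed[OF heard_after[OF assms gst_proposal m(2)] proposer proposal] by blast
  show "tm X k0 \<le> receipt_time X i v"
    by (rule receipt_time_ge[OF proposer proposal f])
  show "receipt_time X i v \<le> tm X k0 + delta X"
    using receipt_time_le[OF f] m(1) by simp
qed

text \<open>For the lower bound, receipt is not before the send and \<Delta> \<ge> \<delta>, while
  the send is at most \<delta> after \<open>s\<close> and hence well before entry plus 3\<Delta>.
  For the upper bound, entry and receipt both happen by \<open>s + 2\<delta>\<close>.\<close>

lemma window_end_bounds:
  assumes i: "i \<in> correct X"
  shows "clk X i (tm X k0 + delta X) \<le> window_end X i v"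
    and "window_end X i v \<le> clk X i (s + 2 * delta X + Delta X)"
proof -
  have e: "clk X i (entry_time X i v) + 3 * Delta X = clk X i (entry_time X i v + 3 * Delta X)"
    and r: "clk X i (receipt_time X i v) + Delta X = clk X i (receipt_time X i v + Delta X)"
    and ub: "clk X i (s + 2 * delta X) + Delta X = clk X i (s + 2 * delta X + Delta X)"
    using clk_add[OF i] entry[OF i] receipt[OF i] gst_entry gst_proposal delta by simp_all
  have "clk X i (tm X k0 + delta X) \<le> clk X i (receipt_time X i v + Delta X)"
    "clk X i (tm X k0 + delta X) \<le> clk X i (entry_time X i v + 3 * Delta X)"
    using clk_mono[OF i] entry[OF i] receipt[OF i] proposal_le delta by simp_all
  then show "clk X i (tm X k0 + delta X) \<le> window_end X i v"
    unfolding window_end_def using e r by linarith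
  have "clk X i (entry_time X i v) \<le> clk X i (s + 2 * delta X)"
    "clk X i (receipt_time X i v) \<le> clk X i (s + 2 * delta X)"
    using clk_mono[OF i] entry[OF i] receipt[OF i] proposal_le delta by simp_all
  then show "window_end X i v \<le> clk X i (s + 2 * delta X + Delta X)"
    unfolding window_end_def using ub by linarith
qed

lemma entry_deadline:
  assumes i: "i \<in> correct X" and "t \<le> s + \<theta>" "0 \<le> \<theta>"
  shows "clk X i t \<le> clk X i (entry_time X i v) + \<theta>"
proof -
  have "clk X i t \<le> clk X i (entry_time X i v + \<theta>)"
    using clk_mono[OF i] entry[OF i] assms(2) by simp
  then show ?thesis
    using clk_add[OF i _ assms(3), of "entry_time X i v"] entry[OF i] gst_entry by simp
qed

section \<open>Echo-stage responses of correct parties\<close>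

lemma echo_deadline_active: "active X i m v B' \<Longrightarrow> echo_deadline X i m v = window_end X i v"
  unfolding echo_deadline_def by (intro if_P exI)

lemma active_B: "fixed X i m v B \<Longrightarrow> entered X i m v \<Longrightarrow> active X i m v B"
  using wf by (simp add: active_def)

lemma active_unique: "active X i m v B' \<Longrightarrow> B' = B"
  using fixed_unique(1)[OF proposer proposal] unfolding active_def by blast

lemma echo_names_B:
  assumes "i \<in> correct X" "ev X k = Bcast i (Echo v g B' cl w)"
  shows "B' = B"
proof (rule active_unique)
  show "active X i k v B'"
    using bcast[OF assms(2,1)] by (cases g) (auto simp: echo_full_rule_def)
qed

lemma fallback_echo:
  assumes "i \<in> correct X" "ev X m = Bcast i (Echo v G0 B' cl w)"
  shows "heard i m (tm X k0)" "\<not> sent X i m (echo_stage v)" "\<And>\<rho>. \<not> enabled X i m \<rho>"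
proof -
  have to: "timeout X i m (window_end X i v)" and "\<not> sent X i m (echo_stage v)"
    using bcast[OF assms(2,1)] by auto
  then show "\<not> sent X i m (echo_stage v)" "\<And>\<rho>. \<not> enabled X i m \<rho>"
    by (simp_all add: timeout_def)
  show "heard i m (tm X k0)"
    by (rule timeout_heard[OF assms(1) gst_proposal assms(2) to window_end_bounds(1)[OF assms(1)]])
qed

text \<open>The deadline of a skip depends on whether a proposal is active, but either value leaves
  \<delta> after the send. So the proposal was heard and is active, and the deadline was the window
  end after all.\<close>

lemma echo_skip:
  assumes i: "i \<in> correct X" and e: "ev X m = Bcast i (EchoSkip v w)"
  shows "heard i m (tm X k0)" "\<not> sent X i m (echo_stage v)"
    "timeout X i m (window_end X i v)" "\<not> core_ok X i m (fst B)"
proof -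
  have st: "\<not> sent X i m (echo_stage v)" "entered X i m v"
    and to: "timeout X i m (echo_deadline X i m v)"
    and core: "\<And>B. active X i m v B \<Longrightarrow> \<not> core_ok X i m (fst B)"
    using bcast[OF e i] by auto
  have "clk X i (tm X k0 + delta X) \<le> clk X i (entry_time X i v) + 3 * Delta X"
    using proposal_le delta by (intro entry_deadline[OF i]) simp_all
  then have "clk X i (tm X k0 + delta X) \<le> echo_deadline X i m v"
    using window_end_bounds(1)[OF i] by (simp add: echo_deadline_def)
  then show h: "heard i m (tm X k0)"
    by (rule timeout_heard[OF i gst_proposal e to])
  have act: "active X i m v B"
    using active_B[OF heard_fixed[OF h proposer proposal] st(2)] .
  then show "\<not> core_ok X i m (fst B)"
    by (rule core)
  have "echo_deadline X i m v = window_end X i v"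
    by (rule echo_deadline_active[OF act])
  then show "timeout X i m (window_end X i v)"
    using to by simp
  show "\<not> sent X i m (echo_stage v)"
    by (rule st(1))
qed

text \<open>The state \<open>m0\<close> is within the window by the clock, yet it may come after the
  skip in the trace. The check is therefore carried back to \<open>m\<close>, reference by
  reference.\<close>

lemma no_echo_skip:
  assumes i: "i \<in> correct X" and m0: "clk X i (now X m0) \<le> window_end X i v" "core_ok X i m0 (fst B)"
  shows "ev X m \<noteq> Bcast i (EchoSkip v w)"
proof
  assume e: "ev X m = Bcast i (EchoSkip v w)"
  note skip = echo_skip[OF i e]
  have "author_ok X i m r" if r: "r \<in> mrefs (fst B)" for r
  proof -
    have ok0: "author_ok X i m0 r"
      using m0(2) r by (simp add: core_ok_def)
    consider "m0 \<le> m" | "m < m0" "fst r = i" | "m < m0" "fst r \<noteq> i"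
      by linarith
    then show ?thesis
    proof cases
      case 1
      then show ?thesis
        using author_ok_mono[OF i ok0] by blast
    next
      \<comment> \<open>The own lane can grow without deliveries. Here the proposer helps: it had
        this lane first-hand when proposing, and \<open>i\<close> has heard everything broadcast by
        then.\<close>
      case 2
      have "direct_pub X (proposer X v) k0 r"
        using proposal_refs[OF proposer proposal] r by (simp add: refs_def)
      then show ?thesis
        using heard_direct_pub[OF skip(1) _ i] 2(2) i by (simp add: author_ok_def)
    next
      case 3
      \<comment> \<open>A delivery after the timeout event lies strictly beyond the window end on
        the local clock, whereas \<open>m0\<close> does not.\<close>
      have "ev X k \<noteq> Deliver j i msg" if k: "m \<le> k" "k < m0" for k j msg
      proof
        assume del: "ev X k = Deliver j i msg"
        then have "m < k"
          using e k(1) by (cases "k = m") auto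
        then have "window_end X i v < clk X i (tm X k)"
          using skip(3) del by (auto simp: timeout_def)
        also have "\<dots> \<le> clk X i (now X m0)"
          using clk_mono[OF i tm_le_now[OF k(2)]] .
        finally show False
          using m0(1) by simp
      qed
      then show ?thesis
        using author_ok_without_delivery[OF i _ _ ok0 3(2)] 3(1) by (meson less_imp_le)
    qed
  qed
  then show False
    using skip(4) by (simp add: core_ok_def)
qed

lemma echo_sent:
  assumes i: "i \<in> correct X"
  shows "\<exists>k msg. ev X k = Bcast i msg \<and> echo_stage v msg \<and> tm X k \<le> s + 2 * delta X + Delta X"
proof -
  obtain m1 where m1: "now X m1 \<le> s + 2 * delta X" "entered X i m1 v"
    using entry_le[OF i] by (auto simp: by_time_def)
  obtain m2 where m2: "now X m2 \<le> tm X k0 + delta X" "\<And>k. tm X k \<le> tm X k0 + delta X \<Longrightarrow> k < m2"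
    using state_at[of "tm X k0 + delta X"] tm_nonneg[of k0] delta(1)
    by (metis add_nonneg_nonneg less_imp_le)
  \<comment> \<open>In this state the view is entered and its proposal fixed, so the echo deadline
    is the window end and has passed by \<open>t\<close>.\<close>
  define m where "m = max m1 m2"
  define t where "t = s + 2 * delta X + Delta X"
  have "fixed X i m v B"
    using heard_fixed[OF heard_mono[OF heard_after[OF i gst_proposal m2(2)]] proposer proposal]
    by (simp add: m_def)
  moreover have ent: "entered X i m v"
    using entered_mono[OF m1(2)] by (simp add: m_def)
  ultimately have "echo_deadline X i m v = window_end X i v"
    using echo_deadline_active active_B by blast
  then have "echo_deadline X i m v \<le> clk X i t"
    using window_end_bounds(2)[OF i] by (simp add: t_def)
  moreover have "now X m \<le> t"
    using m1(1) m2(1) proposal_le delta by (auto simp: m_def t_def max_def)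
  ultimately have "by_time X (max t (gst X)) (\<lambda>k. sent X i k (echo_stage v))"
    using sync ent i unfolding partially_synchronous_def by blast
  moreover have "max t (gst X) = t"
    using gst_entry delta by (simp add: t_def)
  ultimately obtain m' where m': "now X m' \<le> t" "sent X i m' (echo_stage v)"
    by (auto simp: by_time_def)
  then show ?thesis
    using tm_le_now unfolding sent_def t_def by (meson order_trans)
qed

text \<open>The bound by \<open>s + 4 * Delta X\<close> leaves time \<delta> to hear these ECHOs
  before the ready deadline of any correct party, as none enters before \<open>s\<close>.\<close>

definition echoed_by :: "real \<Rightarrow> bool" where
  "echoed_by t \<longleftrightarrow> gst X \<le> t \<and> t + delta X \<le> s + 4 * Delta X \<and>
     (\<forall>j\<in>correct X. \<exists>k g cl w. ev X k = Bcast j (Echo v g B cl w) \<and> tm X k \<le> t)"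

section \<open>READY statements and completion\<close>

lemma ready_names_B:
  assumes "i \<in> correct X" "ev X k = Bcast i (Ready v rg B' w)"
  shows "B' = B"
proof -
  obtain l where "ready_rule X i l v B'"
    using ready_origin[OF assms] by blast
  then have "quorum X \<le> card (echoes X i l v B')"
    by (simp add: ready_rule_def)
  then obtain q where q: "q \<in> echoes X i l v B'" "q \<in> correct X"
    using correct_in_quorum[OF echoes_subset] by blast
  then show ?thesis
    using echo_counted_bcast[OF _ q(2)] echo_names_B[OF q(2)] unfolding echoes_def by blast
qed

lemma heard_echoes:
  assumes "echoed_by t" "heard i m t"
  shows "quorum X \<le> card (echoes X i m v B)"
proof (rule quorum_if_correct_subset[OF _ echoes_subset])
  have "\<exists>g cl. echo_counted X i m j v g B cl" if j: "j \<in> correct X" for j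
    using assms(1) heard_echo[OF assms(2) j] j unfolding echoed_by_def by meson
  then show "correct X \<subseteq> echoes X i m v B"
    by (auto simp: echoes_def correct_party)
qed

text \<open>By the ready deadline all correct ECHOs have been heard, so the READY rule would still
  be enabled, which a timeout forbids.\<close>

lemma no_no_ready:
  assumes "echoed_by t" and i: "i \<in> correct X"
  shows "ev X m \<noteq> Bcast i (NoReady v w)"
proof
  assume e: "ev X m = Bcast i (NoReady v w)"
  have b: "\<not> sent X i m (ready_stage v)" "entered X i m v" "timeout X i m (ready_deadline X i v)"
    using bcast[OF e i] by auto
  have "clk X i (t + delta X) \<le> ready_deadline X i v"
    unfolding ready_deadline_def using assms(1) delta
    by (intro entry_deadline[OF i]) (simp_all add: echoed_by_def)
  then have "heard i m t"
    using timeout_heard[OF i _ e b(3)] assms(1) by (simp add: echoed_by_def)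
  then have "ready_rule X i m v B"
    using heard_echoes[OF assms(1)] b(1,2) view_pos by (simp add: ready_rule_def entered_def)
  then have "enabled X i m (SendReady v)"
    by (auto simp del: split_paired_Ex)
  then show False
    using b(3) unfolding timeout_def by blast
qed

lemma ready_stage_bcast:
  assumes "echoed_by t" "i \<in> correct X" "ev X k = Bcast i msg" "ready_stage v msg"
  shows "\<exists>rg w. msg = Ready v rg B w"
  using assms no_no_ready[OF assms(1,2)] ready_names_B[OF assms(2)] by (cases msg) auto

lemma heard_ready:
  assumes "echoed_by t" "heard i m t'" "j \<in> correct X"
    "ev X k = Bcast j msg" "ready_stage v msg" "tm X k \<le> t'"
  shows "\<exists>rg w l. first_recv X i m j (ready_stage v) (Ready v rg B w) \<and>
    ev X l = Bcast j (Ready v rg B w)"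
proof -
  obtain k' where "k' < m" "recv_at X k' i j msg"
    using heardD[OF assms(2-4,6)] by blast
  then obtain msg' where m': "first_recv X i m j (ready_stage v) msg'"
    using first_recv_exists[of k' i j _ "ready_stage v"] assms(5) by blast
  have "ready_stage v msg'"
    by (rule first_recvD(1)[OF m'])
  moreover from this obtain l where "ev X l = Bcast j msg'"
    using first_recv_bcast[OF m' assms(3)] by fastforce
  ultimately show ?thesis
    using ready_stage_bcast[OF assms(1,3)] m' by blast
qed

lemma all_complete:
  assumes e: "echoed_by t" and i: "i \<in> correct X"
  shows "\<exists>m. completes X i m v B"
proof -
  \<comment> \<open>Correct parties enter by \<open>s + 2\<delta>\<close>, so by time
    \<open>u\<close> all their ready deadlines have expired.\<close>
  define u where "u = s + 2 * delta X + 4 * Delta X"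
  have u: "gst X \<le> u" "0 \<le> u + delta X"
    using gst_entry gst_nonneg delta by (simp_all add: u_def)
  have sent: "\<exists>k msg. ev X k = Bcast j msg \<and> ready_stage v msg \<and> tm X k \<le> u" if j: "j \<in> correct X" for j
  proof -
    obtain m where m: "now X m \<le> s + 2 * delta X" "entered X j m v"
      using entry_le[OF j] by (auto simp: by_time_def)
    have "clk X j (entry_time X j v + 4 * Delta X) \<le> clk X j u"
      using clk_mono[OF j] entry[OF j] by (simp add: u_def)
    then have "ready_deadline X j v \<le> clk X j u"
      using clk_add[OF j, of "entry_time X j v" "4 * Delta X"] entry[OF j] gst_entry delta
      by (simp add: ready_deadline_def)
    moreover have "now X m \<le> u"
      using m(1) delta by (simp add: u_def)
    ultimately have "by_time X (max u (gst X)) (\<lambda>k. sent X j k (ready_stage v))"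
      using sync m(2) j unfolding partially_synchronous_def by blast
    then obtain m' where "now X m' \<le> u" "sent X j m' (ready_stage v)"
      using u(1) by (auto simp: by_time_def)
    then show ?thesis
      using tm_le_now unfolding sent_def by (meson order_trans)
  qed
  obtain m where m: "\<And>k. tm X k \<le> u + delta X \<Longrightarrow> k < m"
    using state_at[OF u(2)] by metis
  have "j \<in> readies X i m v B" if j: "j \<in> correct X" for j
    using heard_ready[OF e heard_after[OF i u(1) m] j] sent[OF j] correct_party[OF j]
    unfolding readies_def by blast
  then show ?thesis
    using quorum_if_correct_subset[OF _ readies_subset] unfolding completes_def by blast
qed

lemma complete_if_core_ok:
  assumes "\<And>i. i \<in> correct X \<Longrightarrow> \<exists>m. clk X i (now X m) \<le> window_end X i v \<and> core_ok X i m (fst B)"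
    and i: "i \<in> correct X"
  shows "\<exists>m. completes X i m v B"
proof -
  have "\<exists>k g cl w. ev X k = Bcast j (Echo v g B cl w) \<and> tm X k \<le> s + 2 * delta X + Delta X"
    if j: "j \<in> correct X" for j
  proof -
    obtain k msg where k: "ev X k = Bcast j msg" "echo_stage v msg" "tm X k \<le> s + 2 * delta X + Delta X"
      using echo_sent[OF j] by blast
    obtain m where "clk X j (now X m) \<le> window_end X j v" "core_ok X j m (fst B)"
      using assms(1)[OF j] by blast
    then have "msg \<noteq> EchoSkip v w" for w
      using no_echo_skip[OF j] k(1) by blast
    then obtain g B' cl w where "msg = Echo v g B' cl w"
      using k(2) by (cases msg) auto
    then show ?thesis
      using k echo_names_B[OF j] by blast
  qed
  \<comment> \<open>Here the durations of the two stages fit together: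
    \<open>2\<delta> + \<Delta> + \<delta> \<le> 4\<Delta>\<close>.\<close>
  then have "echoed_by (s + 2 * delta X + Delta X)"
    using gst_entry delta by (simp add: echoed_by_def)
  then show ?thesis
    using all_complete i by blast
qed

end

section \<open>All parties correct\<close>

locale synchronous_correct_view = synchronous_view X v B k0 s
  for X :: "('s, 'h::linorder, 'x) execution" and v B k0 s +
  assumes no_byz: "byz X = {}"
    and prefix: "prefix_extending X v (tm X k0)"
begin

lemma correct_parties: "correct X = parties X"
  using no_byz by (simp add: correct_def)

lemma proposer_party: "proposer X u \<in> correct X"
proof -
  have "0 < num X"
    using size by linarith
  then have "(u - 1) mod num X < num X"
    by simp
  then show ?thesis
    unfolding correct_parties by (simp add: proposer_def parties_def)
qed

lemma heard_started:
  assumes "heard i m (tm X k0)" "i \<in> correct X"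
  shows "started X i m"
proof -
  obtain k where k: "k < m" "recv_at X k i (proposer X v) (Proposal v B)"
    using heardD[OF assms(1) proposer proposal] by blast
  have "started X i k"
  proof (cases "ev X k = Deliver (proposer X v) i (Proposal v B)")
    case True
    then show ?thesis
      using event[of k] assms(2) by simp
  next
    case False
    then have "ev X k = Bcast i (Proposal v B)"
      using k(2) by (auto simp: recv_at_def)
    then show ?thesis
      by (rule proposal_policy(3)[OF assms(2)])
  qed
  then show ?thesis
    using started_mono k(1) by (meson less_imp_le)
qed

lemma heard_echo_full:
  assumes h: "heard i m (tm X k0)" and i: "i \<in> correct X"
    and st: "\<not> sent X i m (echo_stage v)"
  shows "echo_full_rule X i m v B"
proof -
  have reach: "reaches X i m u" if "u < v" for u
    using that
  proof (induction u)
    case 0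
    show ?case
      by (rule reaches.initial)
  next
    case (Suc u)
    obtain B' k where k: "ev X k = Bcast (proposer X (Suc u)) (Proposal (Suc u) B')"
      "tm X k \<le> tm X k0"
      using prefix Suc.prems unfolding prefix_extending_def proposed_at_def by fastforce
    have "\<exists>k'<m. recv_at X k' i (proposer X (Suc u)) (Proposal (Suc u) B')"
      by (rule heardD[OF h proposer_party k])
    then have "fixed X i m (Suc u) B'"
      using fixedI[OF proposer_party k(1)] by blast
    then show ?case
      using reaches.advance Suc proposal_well_formed[OF proposer_party k(1)] by simp
  qed
  have "fixed X i m v B"
    by (rule heard_fixed[OF h proposer proposal])
  moreover have "reaches X i m (v - 1)" "v = Suc (v - 1)"
    using reach view_pos by simp_all
  ultimately have act: "active X i m v B"
    using wf unfolding active_def activated_def by blast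
  have dp: "direct_pub X i m r" if "r \<in> refs B" for r
    using proposal_refs[OF proposer proposal that] heard_direct_pub[OF h _ i] correct_parties by blast
  then have core: "core_ok X i m (fst B)"
    unfolding core_ok_def author_ok_def refs_def by blast
  have "\<exists>bs. names X (a, k, h) bs \<and> set bs \<subseteq> store X i m \<and> strictly_contains X bs e"
    if T: "snd B a = Some (k, h)" and C: "fst B a = Some e" for a k h e
  proof -
    have "(a, k, h) \<in> refs B"
      using T by (simp add: refs_def mrefs_def)
    then obtain bs where bs: "names X (a, k, h) bs" "set bs \<subseteq> store X i m"
      using dp unfolding direct_pub_def by blast
    \<comment> \<open>The proposer policy already enforces anchoring, and a reference names only one
      lane.\<close>
    moreover obtain bs' where "names X (a, k, h) bs'" "strictly_contains X bs' e"
      using tip_policy_entry[OF proposal_policy(2)[OF proposer proposal] T] C by blast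
    ultimately show ?thesis
      using names_unique by blast
  qed
  then have "tip_ok X i m (fst B) (snd B)"
    using dp unfolding tip_ok_def author_ok_def refs_def by blast
  then show ?thesis
    using act core st view_pos by (simp add: echo_full_rule_def)
qed

text \<open>A fallback ECHO or a skip is a timeout at a party that has heard the proposal. But there
  the full ECHO is still enabled, so no timeout can fire.\<close>

lemma echo_full_only:
  assumes i: "i \<in> correct X" and k: "ev X k = Bcast i msg" "echo_stage v msg"
  shows "\<exists>cl w. msg = Echo v G1 B cl w"
proof -
  have no: False if "heard i k (tm X k0)" "\<not> sent X i k (echo_stage v)" "\<And>\<rho>. \<not> enabled X i k \<rho>"
    using heard_echo_full[OF that(1) i that(2)] that(3)[of "EchoFull v"]
    by (auto simp del: split_paired_Ex split_paired_All)
  show ?thesis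
  proof (cases msg)
    case (Echo u g B' cl w)
    then have e: "ev X k = Bcast i (Echo v g B' cl w)"
      using k by simp
    have "g = G1"
    proof (cases g)
      case G0
      then show ?thesis
        using no fallback_echo[OF i] e by blast
    qed
    then show ?thesis
      using Echo k(2) echo_names_B[OF i e] by simp
  next
    case (EchoSkip u w)
    then have e: "ev X k = Bcast i (EchoSkip v w)"
      using k by simp
    show ?thesis
      using no echo_skip(1-3)[OF i e] unfolding timeout_def by blast
  qed (use k(2) in auto)
qed

lemma state_after:
  assumes "0 \<le> t" "i \<in> correct X" "gst X \<le> u" "u + delta X \<le> t"
  obtains m where "now X m \<le> t" "heard i m u"
proof -
  obtain m where m: "now X m \<le> t" "\<And>k. tm X k \<le> t \<Longrightarrow> k < m"
    using state_at[OF assms(1)] by metis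
  have "heard i m u"
    by (rule heard_after[OF assms(2,3)]) (use m(2) assms(4) in force)
  then show ?thesis
    using that m(1) by blast
qed

lemma rule_taken:
  assumes "i \<in> correct X" "now X m \<le> t" "gst X \<le> t" "enabled X i m \<rho>"
  shows "\<exists>k\<ge>m. \<not> enabled X i k \<rho> \<and> now X k \<le> t"
proof -
  obtain k where "k \<ge> m" "\<not> enabled X i k \<rho>" "now X k \<le> max (now X m) (gst X)"
    using sync assms(1,4) unfolding partially_synchronous_def by meson
  then show ?thesis
    using assms(2,3) by (auto intro: order_trans)
qed

lemma echo_full_sent:
  assumes i: "i \<in> correct X"
  shows "\<exists>k cl w. ev X k = Bcast i (Echo v G1 B cl w) \<and> tm X k \<le> tm X k0 + delta X"
proof -
  have pos: "0 \<le> tm X k0 + delta X" and gst: "gst X \<le> tm X k0 + delta X"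
    using tm_nonneg[of k0] gst_proposal delta(1) by linarith+
  obtain m where m: "now X m \<le> tm X k0 + delta X" "heard i m (tm X k0)"
    using state_after[OF pos i gst_proposal] by blast
  \<comment> \<open>Once the proposal is heard, only a sent echo-stage response can disable the
    rule, now or in a later state of the same time bound.\<close>
  have "\<exists>k. now X k \<le> tm X k0 + delta X \<and> sent X i k (echo_stage v)"
  proof (cases "enabled X i m (EchoFull v)")
    case False
    then have "sent X i m (echo_stage v)"
      using heard_echo_full[OF m(2) i] by (auto simp del: split_paired_Ex split_paired_All)
    then show ?thesis
      using m(1) by blast
  next
    case True
    then obtain k where k: "k \<ge> m" "\<not> enabled X i k (EchoFull v)" "now X k \<le> tm X k0 + delta X"
      using rule_taken[OF i m(1) gst] by blast
    then have "sent X i k (echo_stage v)"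
      using heard_echo_full[OF heard_mono[OF m(2) k(1)] i]
      by (auto simp del: split_paired_Ex split_paired_All)
    then show ?thesis
      using k(3) by blast
  qed
  then obtain k l msg where "now X k \<le> tm X k0 + delta X" "l < k" "ev X l = Bcast i msg" "echo_stage v msg"
    unfolding sent_def by blast
  then show ?thesis
    using echo_full_only[OF i] tm_le_now by (metis order_trans)
qed

lemma echoed: "echoed_by (tm X k0 + delta X)"
  using echo_full_sent proposal_le gst_proposal delta unfolding echoed_by_def by fastforce

lemma fast_seal:
  assumes i: "i \<in> correct X"
  shows "by_time X (tm X k0 + 2 * delta X) (\<lambda>m. fast_seals X i m v (CommitFull (fst B) (snd B)))"
proof -
  obtain m where m: "now X m \<le> tm X k0 + 2 * delta X" "heard i m (tm X k0 + delta X)"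
    using state_after[OF _ i, of "tm X k0 + 2 * delta X" "tm X k0 + delta X"]
      tm_nonneg[of k0] gst_proposal delta(1) by auto
  have "\<exists>cl. echo_counted X i m j v G1 B cl" if "j \<in> parties X" for j
    using echo_full_sent[of j] heard_echo[OF m(2)] that unfolding correct_parties by blast
  then show ?thesis
    using m(1) unfolding by_time_def fast_seals_def by (metis prod.collapse)
qed

lemma ready_full_rule:
  assumes "ready_rule X i m v B'"
  shows "initial_ready_grade X i m v B' = Hom G1"
proof -
  have "g = G1" if j: "j \<in> parties X" and e: "echo_counted X i m j v g B' cl" for j g cl
  proof -
    have j: "j \<in> correct X"
      using j by (simp add: correct_parties)
    then obtain k w where "ev X k = Bcast j (Echo v g B' cl w)"
      using echo_counted_bcast[OF e] by blast
    then show ?thesis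
      using echo_full_only[OF j] by fastforce
  qed
  then have "echoes X i m v B' \<subseteq> graded_echoes X i m v B' G1"
    unfolding echoes_def graded_echoes_def by blast
  then have "card (echoes X i m v B') \<le> card (graded_echoes X i m v B' G1)"
    by (intro card_mono) (simp_all add: graded_echoes_def finite_parties)
  then show ?thesis
    using assms by (simp add: ready_rule_def initial_ready_grade_def)
qed

lemma ready_full_only:
  assumes i: "i \<in> correct X" and k: "ev X k = Bcast i msg" "ready_stage v msg"
  shows "\<exists>w. msg = Ready v (Hom G1) B w"
proof -
  have grade: "rg = Hom G1" if "ready_rule X i l v B'" "rg = initial_ready_grade X i l v B'" for l rg B'
    using that ready_full_rule by simp
  obtain rg w where msg: "msg = Ready v rg B w"
    using ready_stage_bcast[OF echoed i k] by blast
  have "rg = Hom G1"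
    using i k(1)[unfolded msg]
  proof (cases rule: ready_cases)
    case 1
    then show ?thesis
      by (rule grade)
  next
    \<comment> \<open>A refinement presupposes a mix READY; that one would come from the initial
      rule, which produces only grade 1 here.\<close>
    case (2 g)
    then obtain l w' where l: "ev X l = Bcast i (Ready v Mix B w')"
      by (auto simp: refine_rule_def sent_def)
    from i l show ?thesis
      by (cases rule: ready_cases) (use grade in fastforce)+
  qed
  then show ?thesis
    using msg by simp
qed

lemma ready_full_sent:
  assumes i: "i \<in> correct X"
  shows "\<exists>k w. ev X k = Bcast i (Ready v (Hom G1) B w) \<and> tm X k \<le> tm X k0 + 2 * delta X"
proof -
  define t where "t = tm X k0 + 2 * delta X"
  have t: "0 \<le> t" "gst X \<le> t" "gst X \<le> tm X k0 + delta X"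
    using tm_nonneg[of k0] gst_proposal delta(1) by (simp_all add: t_def)
  obtain m where m: "now X m \<le> t" "heard i m (tm X k0 + delta X)"
    using state_after[OF t(1) i t(3)] by (auto simp: t_def)
  \<comment> \<open>From \<open>m\<close> on, nothing but a ready-stage statement can disable the
    READY rule, so its prompt disabling means that one was sent.\<close>
  have ready: "enabled X i l (SendReady v)" if "m \<le> l" "\<not> sent X i l (ready_stage v)" for l
  proof -
    have h: "heard i l (tm X k0 + delta X)"
      by (rule heard_mono[OF m(2) that(1)])
    then have "heard i l (tm X k0)"
      using delta(1) unfolding heard_def by fastforce
    then have "ready_rule X i l v B"
      using heard_started[OF _ i] heard_echoes[OF echoed h] that(2) view_pos
      by (simp add: ready_rule_def)
    then show ?thesis
      by (auto simp del: split_paired_Ex)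
  qed
  have "\<exists>k. now X k \<le> t \<and> sent X i k (ready_stage v)"
  proof (cases "enabled X i m (SendReady v)")
    case False
    then show ?thesis
      using ready[of m] m(1) by blast
  next
    case True
    then show ?thesis
      using rule_taken[OF i m(1) t(2)] ready by blast
  qed
  then obtain k l msg where "now X k \<le> t" "l < k" "ev X l = Bcast i msg" "ready_stage v msg"
    unfolding sent_def by blast
  then show ?thesis
    using ready_full_only[OF i] tm_le_now unfolding t_def by (metis order_trans)
qed

lemma direct_seal:
  assumes i: "i \<in> correct X"
  shows "by_time X (tm X k0 + 3 * delta X) (\<lambda>m. direct_result X i m v (CommitFull (fst B) (snd B)))"
proof -
  obtain m where m: "now X m \<le> tm X k0 + 3 * delta X" "heard i m (tm X k0 + 2 * delta X)"
    using state_after[OF _ i, of "tm X k0 + 3 * delta X" "tm X k0 + 2 * delta X"]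
      tm_nonneg[of k0] gst_proposal delta(1) by auto
  have "j \<in> graded_readies X i m v B G1" if j: "j \<in> correct X" for j
  proof -
    obtain k w where "ev X k = Bcast j (Ready v (Hom G1) B w)" "tm X k \<le> tm X k0 + 2 * delta X"
      using ready_full_sent[OF j] by blast
    then obtain rg w' l where r: "first_recv X i m j (ready_stage v) (Ready v rg B w')"
      "ev X l = Bcast j (Ready v rg B w')"
      using heard_ready[OF echoed m(2) j] by fastforce
    then have "rg = Hom G1"
      using ready_full_only[OF j r(2)] by simp
    then show ?thesis
      using r(1) correct_party[OF j] unfolding graded_readies_def by blast
  qed
  then have hq: "hom_quorum X i m v B G1"
    using quorum_if_correct_subset[of "graded_readies X i m v B G1"] graded_readies_subset readies_subset
    unfolding hom_quorum_def by (meson order_trans subsetI)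
  \<comment> \<open>Only the first homogeneous quorum yields a direct result; uniqueness of
    completions and of grades identifies it with the quorum found at \<open>m\<close>.\<close>
  define l where "l = (LEAST l. \<exists>B' g. hom_quorum X i l v B' g)"
  have "\<exists>B' g. hom_quorum X i l v B' g"
    unfolding l_def by (rule LeastI) (use hq in blast)
  then obtain B' g where l: "hom_quorum X i l v B' g"
    by blast
  have "B' = B"
    using completion_unique hom_quorum_completes l hq by blast
  moreover from this have "g = G1"
    using hom_quorum_unique l hq by blast
  moreover have "l \<le> m"
    unfolding l_def by (rule Least_le) (use hq in blast)
  moreover have "\<not> hom_quorum X i l' v B'' g'" if "l' < l" for l' B'' g'
    using not_less_Least[OF that[unfolded l_def]] by blast
  moreover have "CommitFull (fst B) (snd B) = outcome_of G1 B"
    by (cases B) simp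
  ultimately have "direct_result X i m v (CommitFull (fst B) (snd B))"
    using l unfolding direct_result_def by blast
  then show ?thesis
    using m(1) by (auto simp: by_time_def)
qed

end

section \<open>From the pacemaker cutoff to the claims\<close>

lemma synchronous_view_after_cutoff:
  assumes "vantage_execution X" "partially_synchronous X" "pacemaker_cutoff X c" "c < v"
    "proposer X v \<in> correct X" "proposed_at X v B \<beta>"
  shows "\<exists>k0 s. synchronous_view X v B k0 s \<and> tm X k0 = \<beta>"
proof -
  interpret vantage X
    by standard (rule assms(1))
  obtain k0 where k0: "ev X k0 = Bcast (proposer X v) (Proposal v B)" "tm X k0 = \<beta>"
    using assms(6) by (auto simp: proposed_at_def)
  obtain s where s: "first_entry X v s" "gst X \<le> s"
    "\<forall>i\<in>correct X. by_time X (s + 2 * delta X) (\<lambda>m. entered X i m v)"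
    and "\<exists>B' t. proposed_at X v B' t \<and> well_formed X B' \<and> gst X \<le> t \<and> t \<le> s + delta X"
    using assms(3-5) unfolding pacemaker_cutoff_def by blast
  then obtain B' k where k: "ev X k = Bcast (proposer X v) (Proposal v B')" "well_formed X B'"
    "gst X \<le> tm X k" "tm X k \<le> s + delta X"
    unfolding proposed_at_def by blast
  \<comment> \<open>The cutoff promises some timely proposal; as a correct proposer sends only one,
    it is the given one.\<close>
  then have "k = k0" "B' = B"
    using proposal_unique[OF assms(5) _ k0(1)] by blast+
  then have "synchronous_view X v B k0 s"
    using assms(2,5) k0 k s by unfold_locales auto
  then show ?thesis
    using k0(2) by blast
qed

lemma (in vantage) direct_result_completion:
  assumes "i \<in> correct X" "direct_result X i m v out"
  shows "\<exists>B. (\<exists>j\<in>correct X. \<exists>m'. completes X j m' v B) \<and>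
    (\<forall>j\<in>correct X. \<forall>m' B'. completes X j m' v B' \<longrightarrow> B' = B) \<and> names_payload out B"
proof -
  obtain m0 B g where "hom_quorum X i m0 v B g" and out: "out = outcome_of g B"
    using assms(2) unfolding direct_result_def by blast
  then have "completes X i m0 v B"
    by (intro hom_quorum_completes)
  then show ?thesis
    using assms(1) completion_unique names_payload_outcome unfolding out by blast
qed

theorem theorem5p1:
  fixes X :: "('s, 'h::linorder, 'x) execution"
  assumes "vantage_execution X"
  shows
    "((\<forall>i\<in>correct X. \<forall>j\<in>correct X. \<forall>m m' v B B'.
         completes X i m v B \<and> completes X j m' v B' \<longrightarrow> B = B') \<and>
      (\<forall>i\<in>correct X. \<forall>m v out. direct_result X i m v out \<longrightarrow>
         (\<exists>B. (\<exists>j\<in>correct X. \<exists>m'. completes X j m' v B) \<and>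
              (\<forall>j\<in>correct X. \<forall>m' B'. completes X j m' v B' \<longrightarrow> B' = B) \<and>
              names_payload out B)) \<and>
      (\<forall>i\<in>correct X. \<forall>j\<in>correct X. \<forall>m m' v C T C'.
         \<not> (direct_result X i m v (CommitFull C T) \<and> direct_result X j m' v (CommitCore C'))) \<and>
      (\<forall>i\<in>correct X. \<forall>m v C T. completes X i m v (C, T) \<longrightarrow>
         valid_manifest X C \<and> author_backed X m C \<and> retrievable X m C)) \<and>
     (partially_synchronous X \<longrightarrow>
      (\<forall>c v C T \<beta>. pacemaker_cutoff X c \<and> c < v \<and> proposer X v \<in> correct X \<and>
         proposed_at X v (C, T) \<beta> \<and>
         (\<forall>i\<in>correct X. \<exists>m. clk X i (now X m) \<le> window_end X i v \<and> core_ok X i m C) \<longrightarrow>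
         (\<forall>i\<in>correct X. \<exists>m. completes X i m v (C, T))) \<and>
      (\<forall>r v C T \<beta>. all_correct_responsive_suffix X r \<and> r \<le> v \<and>
         proposed_at X v (C, T) \<beta> \<and> prefix_extending X v \<beta> \<longrightarrow>
         (\<forall>i\<in>parties X.
            by_time X (\<beta> + 2 * delta X) (\<lambda>m. fast_seals X i m v (CommitFull C T)) \<and>
            by_time X (\<beta> + 3 * delta X) (\<lambda>m. direct_result X i m v (CommitFull C T)))))"
proof -
  interpret vantage X
    by standard (rule assms)
  have live: "\<exists>m. completes X i m v (C, T)"
    if ps: "partially_synchronous X" and cut: "pacemaker_cutoff X c" "c < v" "proposer X v \<in> correct X"
      "proposed_at X v (C, T) \<beta>"
    and core: "\<forall>i\<in>correct X. \<exists>m. clk X i (now X m) \<le> window_end X i v \<and> core_ok X i m C"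
    and i: "i \<in> correct X" for c v C T \<beta> i
  proof -
    obtain k0 s where "synchronous_view X v (C, T) k0 s"
      using synchronous_view_after_cutoff[OF assms ps cut] by blast
    then show ?thesis
      using synchronous_view.complete_if_core_ok[of X v "(C, T)" k0 s i] core i by simp
  qed
  have fast: "by_time X (\<beta> + 2 * delta X) (\<lambda>m. fast_seals X i m v (CommitFull C T)) \<and>
      by_time X (\<beta> + 3 * delta X) (\<lambda>m. direct_result X i m v (CommitFull C T))"
    if ps: "partially_synchronous X" and suf: "all_correct_responsive_suffix X r" and v: "r \<le> v"
      and pr: "proposed_at X v (C, T) \<beta>" and ext: "prefix_extending X v \<beta>" and i: "i \<in> parties X"
    for r v C T \<beta> i
  proof -
    obtain c where c: "c < r" "pacemaker_cutoff X c" and byz: "byz X = {}"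
      using suf by (auto simp: all_correct_responsive_suffix_def all_correct_cutoff_def)
    have all: "correct X = parties X"
      using byz by (simp add: correct_def)
    obtain k where "ev X k = Bcast (proposer X v) (Proposal v (C, T))"
      using pr by (auto simp: proposed_at_def)
    then have p: "proposer X v \<in> correct X"
      using event[of k] all by simp
    have "c < v"
      using c(1) v by simp
    then obtain k0 s where "synchronous_view X v (C, T) k0 s" and k0: "tm X k0 = \<beta>"
      using synchronous_view_after_cutoff[OF assms ps c(2) _ p pr] by blast
    then interpret synchronous_view X v "(C, T)" k0 s
      by simp
    interpret synchronous_correct_view X v "(C, T)" k0 s
      using byz ext k0 by unfold_locales auto
    show ?thesis
      using fast_seal direct_seal i all k0 by simp
  qed
  show ?thesis
  proof (rule conjI, intro conjI)
    show "\<forall>i\<in>correct X. \<forall>j\<in>correct X. \<forall>m m' v B B'.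
        completes X i m v B \<and> completes X j m' v B' \<longrightarrow> B = B'"
      using completion_unique by blast
    show "\<forall>i\<in>correct X. \<forall>m v out. direct_result X i m v out \<longrightarrow>
        (\<exists>B. (\<exists>j\<in>correct X. \<exists>m'. completes X j m' v B) \<and>
             (\<forall>j\<in>correct X. \<forall>m' B'. completes X j m' v B' \<longrightarrow> B' = B) \<and> names_payload out B)"
      by (intro ballI allI impI) (rule direct_result_completion)
    show "\<forall>i\<in>correct X. \<forall>j\<in>correct X. \<forall>m m' v C T C'.
        \<not> (direct_result X i m v (CommitFull C T) \<and> direct_result X j m' v (CommitCore C'))"
      using direct_result_unique by blast
    show "\<forall>i\<in>correct X. \<forall>m v C T. completes X i m v (C, T) \<longrightarrow>
        valid_manifest X C \<and> author_backed X m C \<and> retrievable X m C"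
      using completion_core by blast
  qed (intro impI conjI allI ballI; elim conjE; (rule live fast[THEN conjunct1] fast[THEN conjunct2]; assumption))
qed

end
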